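(* There is no cyclic metric Lie group with strictly positive sectional curvature.
   Context: A metric Lie group $(G,g)$ is a connected real Lie group $G$ equipped with a left-invariant Riemannian metric $g$; $\mathfrak{g}$ is its Lie algebra and $\langle\cdot,\cdot\rangle$ is the inner product on $\mathfrak{g}$ corresponding to $g$. $(G,g)$ is called cyclic if $\langle [X,Y],Z\rangle+\langle [Y,Z],X\rangle+\langle [Z,X],Y\rangle=0$ for all $X,Y,Z\in\mathfrak{g}$. Strictly positive sectional curvature means that the Riemannian sectional curvature of $g$ is positive on every tangent plane.
   Formalization: The formal statement assumes the Lie group has dimension at least 2; in dimension 0 or 1 there are no tangent planes, so strict positivity holds vacuously and, e.g., the real line with its Euclidean metric would be a counterexample. *)

theory Defs
  imports "HOL-Analysis.Analysis" "HOL-Algebra.Group"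
begin

section \<open>Smooth maps between Euclidean spaces\<close>

text \<open>
  Meant for open \<open>S\<close>. Requiring all directional derivatives \<open>x \<mapsto> Df(x) w\<close> to be
  \<open>k\<close> times continuously differentiable is the usual inductive definition of the class
  \<open>C^(k+1)\<close> in finite dimension.
\<close>

primrec C_k_on ::
  "nat \<Rightarrow> ('e::euclidean_space \<Rightarrow> 'f::real_normed_vector) \<Rightarrow> 'e set \<Rightarrow> bool" where
  "C_k_on 0 f S \<longleftrightarrow> continuous_on S f"
| "C_k_on (Suc k) f S \<longleftrightarrow>
     (\<forall>x\<in>S. f differentiable (at x)) \<and>
     (\<forall>w. C_k_on k (\<lambda>x. frechet_derivative f (at x) w) S)"

definition smooth_on :: "'e::euclidean_space set \<Rightarrow> ('e \<Rightarrow> 'f::real_normed_vector) \<Rightarrow> bool" where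
  "smooth_on S f \<longleftrightarrow> (\<forall>k. C_k_on k f S)"


section \<open>Smooth manifolds\<close>

text \<open>
  A manifold is an abstract topology \<open>T\<close> with an atlas \<open>A\<close> modelled on a Euclidean space
  \<open>'e\<close>, so its dimension is \<open>DIM('e)\<close>. Atlases are not required to be maximal.
  Charts and all functions on the manifold are total HOL functions on the type \<open>'a\<close>; only
  their values on the chart domain, respectively on \<open>topspace T\<close>, matter.
\<close>

type_synonym ('a, 'e) chart = "'a set \<times> ('a \<Rightarrow> 'e)"
type_synonym 'a tangent_vector = "('a \<Rightarrow> real) \<Rightarrow> real"
type_synonym 'a vector_field = "'a \<Rightarrow> 'a tangent_vector"

locale smooth_manifold =
  fixes T :: "'a topology" and A :: "('a, 'e::euclidean_space) chart set"
  assumes Hausdorff: "Hausdorff_space T"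
    and second_countable: "second_countable T"
    and charts: "(U, \<phi>) \<in> A \<Longrightarrow> openin T U \<and> open (\<phi> ` U) \<and>
          homeomorphic_map (subtopology T U) (top_of_set (\<phi> ` U)) \<phi>"
    and charts_cover: "(\<Union>(U, \<phi>)\<in>A. U) = topspace T"
    and charts_compatible: "(U, \<phi>) \<in> A \<Longrightarrow> (V, \<psi>) \<in> A \<Longrightarrow>
          smooth_on (\<phi> ` (U \<inter> V)) (\<psi> \<circ> inv_into U \<phi>)"

definition prod_atlas ::
  "('a, 'e::euclidean_space) chart set \<Rightarrow> ('b, 'f::euclidean_space) chart set
    \<Rightarrow> ('a \<times> 'b, 'e \<times> 'f) chart set" where
  "prod_atlas A B = {(U \<times> V, map_prod \<phi> \<psi>) | U \<phi> V \<psi>. (U, \<phi>) \<in> A \<and> (V, \<psi>) \<in> B}"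

definition smooth_map ::
  "'a topology \<Rightarrow> ('a, 'e::euclidean_space) chart set \<Rightarrow>
   'b topology \<Rightarrow> ('b, 'f::euclidean_space) chart set \<Rightarrow> ('a \<Rightarrow> 'b) \<Rightarrow> bool" where
  "smooth_map T A T' B F \<longleftrightarrow> continuous_map T T' F \<and>
     (\<forall>(U, \<phi>)\<in>A. \<forall>(V, \<psi>)\<in>B. smooth_on (\<phi> ` (U \<inter> F -` V)) (\<psi> \<circ> F \<circ> inv_into U \<phi>))"

context smooth_manifold
begin

definition smooth_fun_on :: "'a set \<Rightarrow> ('a \<Rightarrow> real) \<Rightarrow> bool" where
  "smooth_fun_on W f \<longleftrightarrow> (\<forall>(U, \<phi>)\<in>A. smooth_on (\<phi> ` (U \<inter> W)) (f \<circ> inv_into U \<phi>))"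

definition smooth_near :: "'a \<Rightarrow> ('a \<Rightarrow> real) \<Rightarrow> bool" where
  "smooth_near p f \<longleftrightarrow> (\<exists>W. openin T W \<and> p \<in> W \<and> smooth_fun_on W f)"

text \<open>
  Tangent vectors at \<open>p\<close> are the derivations at \<open>p\<close> of the functions that are smooth near
  \<open>p\<close>, extended by 0 to all other functions so that equality of tangent vectors is equality in
  HOL. They depend only on germs: if \<open>f = h\<close> on an open neighbourhood \<open>W\<close> of \<open>p\<close>, apply
  the Leibniz rule to \<open>(f - h) * indicator W\<close>. For \<open>p\<close> outside the manifold no function is
  smooth near \<open>p\<close>, and the tangent space is \<open>{0}\<close>.
\<close>

definition tangent_space :: "'a \<Rightarrow> 'a tangent_vector set" where
  "tangent_space p = {v.
     (\<forall>f. \<not> smooth_near p f \<longrightarrow> v f = 0) \<and>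
     (\<forall>f h a b. smooth_near p f \<and> smooth_near p h \<longrightarrow>
        v (\<lambda>x. a * f x + b * h x) = a * v f + b * v h) \<and>
     (\<forall>f h. smooth_near p f \<and> smooth_near p h \<longrightarrow>
        v (\<lambda>x. f x * h x) = v f * h p + f p * v h)}"

definition push_forward :: "('a \<Rightarrow> 'a) \<Rightarrow> 'a \<Rightarrow> 'a tangent_vector \<Rightarrow> 'a tangent_vector" where
  "push_forward F p v = (\<lambda>f. if smooth_near (F p) f then v (f \<circ> F) else 0)"

text \<open>
  Smooth vector fields on the whole manifold; outside \<open>topspace T\<close> they vanish because the
  tangent space there is \<open>{0}\<close>.
\<close>

definition vector_fields :: "'a vector_field set" where
  "vector_fields = {Y. (\<forall>p. Y p \<in> tangent_space p) \<and>
     (\<forall>W f. openin T W \<and> smooth_fun_on W f \<longrightarrow> smooth_fun_on W (\<lambda>p. Y p f))}"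

definition vf_add :: "'a vector_field \<Rightarrow> 'a vector_field \<Rightarrow> 'a vector_field" where
  "vf_add Y Z = (\<lambda>p f. Y p f + Z p f)"

definition vf_diff :: "'a vector_field \<Rightarrow> 'a vector_field \<Rightarrow> 'a vector_field" where
  "vf_diff Y Z = (\<lambda>p f. Y p f - Z p f)"

definition vf_scale :: "('a \<Rightarrow> real) \<Rightarrow> 'a vector_field \<Rightarrow> 'a vector_field" where
  "vf_scale h Y = (\<lambda>p f. h p * Y p f)"

definition lie_bracket :: "'a vector_field \<Rightarrow> 'a vector_field \<Rightarrow> 'a vector_field" where
  "lie_bracket Y Z = (\<lambda>p f. if smooth_near p f
     then Y p (\<lambda>q. Z q f) - Z p (\<lambda>q. Y q f) else 0)"

definition affine_connection ::
  "('a vector_field \<Rightarrow> 'a vector_field \<Rightarrow> 'a vector_field) \<Rightarrow> bool" where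
  "affine_connection D \<longleftrightarrow>
     (\<forall>Y\<in>vector_fields. \<forall>Z\<in>vector_fields. D Y Z \<in> vector_fields) \<and>
     (\<forall>Y\<in>vector_fields. \<forall>Y'\<in>vector_fields. \<forall>Z\<in>vector_fields.
        D (vf_add Y Y') Z = vf_add (D Y Z) (D Y' Z)) \<and>
     (\<forall>Y\<in>vector_fields. \<forall>Z\<in>vector_fields. \<forall>Z'\<in>vector_fields.
        D Y (vf_add Z Z') = vf_add (D Y Z) (D Y Z')) \<and>
     (\<forall>Y\<in>vector_fields. \<forall>Z\<in>vector_fields. \<forall>h. smooth_fun_on (topspace T) h \<longrightarrow>
        D (vf_scale h Y) Z = vf_scale h (D Y Z) \<and>
        D Y (vf_scale h Z) = vf_add (vf_scale h (D Y Z)) (vf_scale (\<lambda>p. Y p h) Z))"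

definition torsion_free ::
  "('a vector_field \<Rightarrow> 'a vector_field \<Rightarrow> 'a vector_field) \<Rightarrow> bool" where
  "torsion_free D \<longleftrightarrow>
     (\<forall>Y\<in>vector_fields. \<forall>Z\<in>vector_fields. vf_diff (D Y Z) (D Z Y) = lie_bracket Y Z)"

definition curvature ::
  "('a vector_field \<Rightarrow> 'a vector_field \<Rightarrow> 'a vector_field) \<Rightarrow>
   'a vector_field \<Rightarrow> 'a vector_field \<Rightarrow> 'a vector_field \<Rightarrow> 'a vector_field" where
  "curvature D Y Z W =
     vf_diff (vf_diff (D Y (D Z W)) (D Z (D Y W))) (D (lie_bracket Y Z) W)"

definition linearly_independent_pair :: "'a tangent_vector \<Rightarrow> 'a tangent_vector \<Rightarrow> bool" where
  "linearly_independent_pair u v \<longleftrightarrow>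
     (\<forall>a b. (\<lambda>f. a * u f + b * v f) = (\<lambda>f. 0) \<longrightarrow> a = 0 \<and> b = 0)"

end


section \<open>Riemannian manifolds\<close>

locale riemannian_manifold = smooth_manifold T A
  for T :: "'a topology" and A :: "('a, 'e::euclidean_space) chart set" +
  fixes g :: "'a \<Rightarrow> 'a tangent_vector \<Rightarrow> 'a tangent_vector \<Rightarrow> real"
  assumes metric_linear: "p \<in> topspace T \<Longrightarrow> u \<in> tangent_space p \<Longrightarrow> v \<in> tangent_space p \<Longrightarrow>
          w \<in> tangent_space p \<Longrightarrow> g p (\<lambda>f. a * u f + b * v f) w = a * g p u w + b * g p v w"
    and metric_sym: "p \<in> topspace T \<Longrightarrow> u \<in> tangent_space p \<Longrightarrow> v \<in> tangent_space p \<Longrightarrow>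
          g p u v = g p v u"
    and metric_pos: "p \<in> topspace T \<Longrightarrow> v \<in> tangent_space p \<Longrightarrow> v \<noteq> (\<lambda>f. 0) \<Longrightarrow> 0 < g p v v"
    and metric_smooth: "Y \<in> vector_fields \<Longrightarrow> Z \<in> vector_fields \<Longrightarrow>
          smooth_fun_on (topspace T) (\<lambda>p. g p (Y p) (Z p))"
begin

definition metric_compatible ::
  "('a vector_field \<Rightarrow> 'a vector_field \<Rightarrow> 'a vector_field) \<Rightarrow> bool" where
  "metric_compatible D \<longleftrightarrow>
     (\<forall>Y\<in>vector_fields. \<forall>Z\<in>vector_fields. \<forall>W\<in>vector_fields. \<forall>p\<in>topspace T.
        Y p (\<lambda>q. g q (Z q) (W q)) = g p (D Y Z p) (W p) + g p (Z p) (D Y W p))"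

text \<open>
  The conditions determine \<open>D Y Z\<close> uniquely for \<open>Y\<close> and \<open>Z\<close> in \<open>vector_fields\<close>;
  its values on arguments that are not smooth vector fields are irrelevant, whence
  \<open>SOME\<close> instead of \<open>THE\<close>.
\<close>

definition levi_civita :: "'a vector_field \<Rightarrow> 'a vector_field \<Rightarrow> 'a vector_field" where
  "levi_civita = (SOME D. affine_connection D \<and> torsion_free D \<and> metric_compatible D)"

text \<open>
  The sectional curvature at \<open>p\<close> of the plane spanned by \<open>Y p\<close> and \<open>Z p\<close>, for linearly
  independent \<open>Y p\<close> and \<open>Z p\<close>.
\<close>

definition sectional_curvature :: "'a \<Rightarrow> 'a vector_field \<Rightarrow> 'a vector_field \<Rightarrow> real" where
  "sectional_curvature p Y Z =
     g p (curvature levi_civita Y Z Z p) (Y p) /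
     (g p (Y p) (Y p) * g p (Z p) (Z p) - (g p (Y p) (Z p))\<^sup>2)"

text \<open>
  Every tangent plane is spanned by the values of two globally defined smooth vector fields, so
  the following quantifies over all tangent planes.
\<close>

definition positive_sectional_curvature :: bool where
  "positive_sectional_curvature \<longleftrightarrow>
     (\<forall>p\<in>topspace T. \<forall>Y\<in>vector_fields. \<forall>Z\<in>vector_fields.
        linearly_independent_pair (Y p) (Z p) \<longrightarrow> 0 < sectional_curvature p Y Z)"

end


section \<open>Metric Lie groups\<close>

locale lie_group = group G + smooth_manifold T A
  for G :: "('a, 'b) monoid_scheme" (structure)
    and T :: "'a topology" and A :: "('a, 'e::euclidean_space) chart set" +
  assumes topspace_carrier: "topspace T = carrier G"
    and smooth_mult: "smooth_map (prod_topology T T) (prod_atlas A A) T A (\<lambda>(x, y). x \<otimes> y)"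
    and smooth_inv: "smooth_map T A T A (\<lambda>x. inv x)"
begin

definition left_invariant_fields :: "'a vector_field set" where
  "left_invariant_fields = {Y \<in> vector_fields.
     \<forall>a\<in>carrier G. \<forall>p\<in>carrier G. push_forward (\<lambda>x. a \<otimes> x) p (Y p) = Y (a \<otimes> p)}"

end

locale metric_lie_group = lie_group G T A + riemannian_manifold T A g
  for G :: "('a, 'b) monoid_scheme" (structure)
    and T :: "'a topology" and A :: "('a, 'e::euclidean_space) chart set"
    and g :: "'a \<Rightarrow> 'a tangent_vector \<Rightarrow> 'a tangent_vector \<Rightarrow> real" +
  assumes connected: "connected_space T"
    and left_invariant_metric:
      "a \<in> carrier G \<Longrightarrow> p \<in> carrier G \<Longrightarrow> u \<in> tangent_space p \<Longrightarrow> v \<in> tangent_space p \<Longrightarrow>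
       g (a \<otimes> p) (push_forward (\<lambda>x. a \<otimes> x) p u) (push_forward (\<lambda>x. a \<otimes> x) p v) = g p u v"
begin

text \<open>
  The Lie algebra of \<open>G\<close> is \<open>left_invariant_fields\<close> with \<open>lie_bracket\<close>.
\<close>

definition lie_algebra_inner :: "'a vector_field \<Rightarrow> 'a vector_field \<Rightarrow> real" where
  "lie_algebra_inner Y Z = g \<one> (Y \<one>) (Z \<one>)"

definition cyclic :: bool where
  "cyclic \<longleftrightarrow>
     (\<forall>X\<in>left_invariant_fields. \<forall>Y\<in>left_invariant_fields. \<forall>Z\<in>left_invariant_fields.
        lie_algebra_inner (lie_bracket X Y) Z + lie_algebra_inner (lie_bracket Y Z) X +
        lie_algebra_inner (lie_bracket Z X) Y = 0)"

end

end

theory Submission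
  imports Defs
begin

text \<open>
  The scalar curvature of a cyclic left-invariant metric is nonpositive, whereas a metric of
  positive sectional curvature in dimension at least 2 has positive scalar curvature.

  Let \<open>E\<^sub>1, \<dots>, E\<^sub>n\<close> be an orthonormal basis of the Lie algebra and
  \<open>c\<^sub>i\<^sub>j\<^sub>k = \<langle>[E\<^sub>i, E\<^sub>j], E\<^sub>k\<rangle>\<close>. As the inner products of left-invariant fields are constant,
  the Koszul formula reads
  \<open>2 \<langle>\<nabla>\<^bsub>E\<^sub>i\<^esub> E\<^sub>j, E\<^sub>k\<rangle> = c\<^sub>i\<^sub>j\<^sub>k - c\<^sub>j\<^sub>k\<^sub>i + c\<^sub>k\<^sub>i\<^sub>j\<close>, and cyclicity, \<open>c\<^sub>i\<^sub>j\<^sub>k + c\<^sub>j\<^sub>k\<^sub>i + c\<^sub>k\<^sub>i\<^sub>j = 0\<close>, collapses it to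
  \<open>\<langle>\<nabla>\<^bsub>E\<^sub>i\<^esub> E\<^sub>j, E\<^sub>k\<rangle> = c\<^sub>k\<^sub>j\<^sub>i\<close>. Hence the sectional curvature of the plane of \<open>E\<^sub>i\<close> and \<open>E\<^sub>j\<close> is
  \<open>K\<^sub>i\<^sub>j = \<Sum>\<^sub>k (- c\<^sub>k\<^sub>j\<^sub>j c\<^sub>k\<^sub>i\<^sub>i + c\<^sub>k\<^sub>j\<^sub>i c\<^sub>k\<^sub>i\<^sub>j - c\<^sub>i\<^sub>j\<^sub>k c\<^sub>i\<^sub>j\<^sub>k)\<close> (\<open>frame_curvature\<close>). Summed over all \<open>i\<close> and \<open>j\<close>, the first
  term gives minus a sum of squares, and by \<open>2 x y \<le> x\<^sup>2 + y\<^sup>2\<close> the second one is at most the third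
  (\<open>scalar_curvature_sum_nonpos\<close>). But \<open>K\<^sub>i\<^sub>i = 0\<close>, so positive curvature would make the sum
  positive as soon as there are two basis vectors.

  Most of the text connects this computation with abstract manifolds, where tangent vectors are
  derivations and the Levi-Civita connection is picked by Hilbert choice among all connections that
  are torsion-free and metric. Two facts are essential. Every derivation is a
  directional derivative in a chart, by Hadamard's lemma (\<open>tangent_eq_chart_derivation\<close>); this makes
  the tangent spaces finite-dimensional and the left-invariant extensions of tangent vectors
  smooth, and yields an orthonormal frame of left-invariant fields
  (\<open>left_invariant_orthonormal_frame\<close>). And a manifold with a global orthonormal
  frame has a Levi-Civita connection, since the Koszul formula can be read as a definition in the
  frame (\<open>levi_civita_connection\<close>).
\<close>

section \<open>Calculus of smooth maps\<close>

lemma C_k_on_cong_open: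
  assumes "open S" "\<And>x. x \<in> S \<Longrightarrow> f x = g x" "C_k_on k f S"
  shows "C_k_on k g S"
  using assms(2,3)
proof (induction k arbitrary: f g)
  case 0
  then show ?case using continuous_on_cong[of S S f g] by simp
next
  case (Suc k)
  have d: "(g has_derivative frechet_derivative f (at x)) (at x)" if "x \<in> S" for x
    using Suc.prems that assms(1)
    by (auto simp: frechet_derivative_works intro!: has_derivative_transform_within_open[of f _ x UNIV S g])
  then have fd: "frechet_derivative g (at x) = frechet_derivative f (at x)" if "x \<in> S" for x
    using that frechet_derivative_at by metis
  show ?case
  proof (simp, intro conjI ballI allI)
    show "g differentiable at x" if "x \<in> S" for x
      using d[OF that] by (auto simp: differentiable_def)
    show "C_k_on k (\<lambda>x. frechet_derivative g (at x) w) S" for w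
      by (rule Suc.IH[of "\<lambda>x. frechet_derivative f (at x) w"]) (use Suc.prems fd in auto)
  qed
qed

lemma C_k_on_subset: "C_k_on k f S \<Longrightarrow> R \<subseteq> S \<Longrightarrow> C_k_on k f R"
proof (induction k arbitrary: f)
  case 0 then show ?case using continuous_on_subset by auto
next
  case (Suc k) then show ?case by auto
qed

lemma C_k_on_local:
  assumes "\<And>x. x \<in> S \<Longrightarrow> \<exists>N. open N \<and> x \<in> N \<and> C_k_on k f N"
  shows "C_k_on k f S"
  using assms
proof (induction k arbitrary: f)
  case 0
  show ?case unfolding C_k_on.simps
  proof (rule continuous_at_imp_continuous_on, rule ballI)
    fix x assume "x \<in> S"
    then show "isCont f x"
      using "0.prems" by (metis C_k_on.simps(1) continuous_on_eq_continuous_at)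
  qed
next
  case (Suc k)
  then show ?case unfolding C_k_on.simps by metis
qed

lemma C_k_on_SucI:
  assumes "open S" "\<And>x. x \<in> S \<Longrightarrow> (f has_derivative f' x) (at x)"
    and "\<And>w. C_k_on k (\<lambda>x. f' x w) S"
  shows "C_k_on (Suc k) f S"
proof -
  have "frechet_derivative f (at x) = f' x" if "x \<in> S" for x
    using assms(2)[OF that] frechet_derivative_at by metis
  then have "C_k_on k (\<lambda>x. frechet_derivative f (at x) w) S" for w
    by (intro C_k_on_cong_open[OF assms(1) _ assms(3)]) simp
  then show ?thesis using assms(2) by (auto simp: differentiable_def)
qed

lemma C_k_on_SucD:
  assumes "C_k_on (Suc k) f S" "x \<in> S"
  shows "(f has_derivative frechet_derivative f (at x)) (at x)"
  using assms by (simp add: frechet_derivative_works)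

lemma C_k_on_Suc_imp: "C_k_on (Suc k) f S \<Longrightarrow> C_k_on k f S"
proof (induction k arbitrary: f)
  case 0
  then show ?case
    by (auto intro!: continuous_at_imp_continuous_on differentiable_imp_continuous_within)
next
  case (Suc k)
  then show ?case
    by (metis C_k_on.simps(2))
qed

lemma C_k_on_imp_continuous_on: "C_k_on k f S \<Longrightarrow> continuous_on S f"
proof (induction k)
  case (Suc k)
  then show ?case using C_k_on_Suc_imp by blast
qed simp

lemma C_k_on_const: "C_k_on k (\<lambda>x. c) S"
  by (induction k arbitrary: c) simp_all

lemma C_k_on_bounded_linear_comp:
  assumes "bounded_linear L" "open S" "C_k_on k f S"
  shows "C_k_on k (\<lambda>x. L (f x)) S"
  using assms(3)
proof (induction k arbitrary: f)
  case 0
  then show ?case using bounded_linear.continuous_on[OF assms(1)] by simp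
next
  case (Suc k)
  show ?case
    by (rule C_k_on_SucI[OF assms(2) bounded_linear.has_derivative[OF assms(1) C_k_on_SucD[OF Suc.prems]]])
      (use Suc in auto)
qed

lemma C_k_on_ident: "open S \<Longrightarrow> C_k_on k (\<lambda>x. x) S"
  by (cases k) (auto intro!: C_k_on_SucI C_k_on_const derivative_eq_intros simp del: C_k_on.simps(2))

lemma C_k_on_add:
  assumes "open S" "C_k_on k f S" "C_k_on k g S"
  shows "C_k_on k (\<lambda>x. f x + g x) S"
  using assms(2,3)
proof (induction k arbitrary: f g)
  case 0
  then show ?case by (auto intro: continuous_intros)
next
  case (Suc k)
  show ?case
    by (rule C_k_on_SucI[OF assms(1) has_derivative_add[OF C_k_on_SucD[OF Suc.prems(1)] C_k_on_SucD[OF Suc.prems(2)]]])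
      (use Suc in auto)
qed

lemma C_k_on_sum:
  assumes "open S" "\<And>i. i \<in> I \<Longrightarrow> C_k_on k (f i) S"
  shows "C_k_on k (\<lambda>x. \<Sum>i\<in>I. f i x) S"
  using assms(2)
  by (induction I rule: infinite_finite_induct) (simp_all add: C_k_on_const C_k_on_add assms(1))

lemma C_k_on_bilinear:
  assumes "bounded_bilinear B" "open S" "C_k_on k f S" "C_k_on k g S"
  shows "C_k_on k (\<lambda>x. B (f x) (g x)) S"
  using assms(3,4)
proof (induction k arbitrary: f g)
  case 0
  then show ?case by (auto intro: bounded_bilinear.continuous_on[OF assms(1)])
next
  case (Suc k)
  show ?case
  proof (rule C_k_on_SucI[OF assms(2) bounded_bilinear.FDERIV[OF assms(1) C_k_on_SucD[OF Suc.prems(1)] C_k_on_SucD[OF Suc.prems(2)]]])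
    show "C_k_on k (\<lambda>x. B (f x) (frechet_derivative g (at x) w) + B (frechet_derivative f (at x) w) (g x)) S" for w
      using Suc.prems Suc.prems[THEN C_k_on_Suc_imp]
      by (intro C_k_on_add[OF assms(2)] Suc.IH) simp_all
  qed
qed

lemma has_derivative_Basis_expansion:
  fixes f :: "'e::euclidean_space \<Rightarrow> 'f::real_normed_vector"
  assumes "(f has_derivative f') F"
  shows "f' w = (\<Sum>b\<in>Basis. (w \<bullet> b) *\<^sub>R f' b)"
proof -
  interpret bounded_linear f' using assms has_derivative_bounded_linear by blast
  have "f' w = f' (\<Sum>b\<in>Basis. (w \<bullet> b) *\<^sub>R b)" by (simp add: euclidean_representation)
  then show ?thesis by (simp add: sum scaleR)
qed

text \<open>
  The chain rule expresses a directional derivative of the composite through the partial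
  derivatives of the outer map, \<open>D(f \<circ> h)(x) w = \<Sum>\<^sub>b (Dh(x) w \<bullet> b) D f(h(x)) b\<close>. Its summands
  are products of functions to which the induction hypothesis applies.
\<close>
lemma C_k_on_compose:
  fixes f :: "'e::euclidean_space \<Rightarrow> 'f::real_normed_vector" and h :: "'d::euclidean_space \<Rightarrow> 'e"
  assumes "open S" "h ` S \<subseteq> R" "C_k_on k h S" "C_k_on k f R"
  shows "C_k_on k (\<lambda>x. f (h x)) S"
  using assms(3,4)
proof (induction k arbitrary: f)
  case 0
  then show ?case using assms(2) continuous_on_compose2 by auto
next
  case (Suc k)
  have hk: "C_k_on k h S" using Suc.prems(1) by (rule C_k_on_Suc_imp)
  show ?case
  proof (rule C_k_on_SucI[OF assms(1)])
    fix x assume x: "x \<in> S"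
    have f: "(f has_derivative frechet_derivative f (at (h x))) (at (h x))"
      using x assms(2) by (intro C_k_on_SucD[OF Suc.prems(2)]) auto
    have "((\<lambda>x. f (h x)) has_derivative (\<lambda>w. frechet_derivative f (at (h x)) (frechet_derivative h (at x) w))) (at x)"
      using diff_chain_at[OF C_k_on_SucD[OF Suc.prems(1) x] f] by (simp add: comp_def)
    then show "((\<lambda>x. f (h x)) has_derivative
        (\<lambda>w. \<Sum>b\<in>Basis. (frechet_derivative h (at x) w \<bullet> b) *\<^sub>R frechet_derivative f (at (h x)) b)) (at x)"
      by (subst (asm) has_derivative_Basis_expansion[OF f])
  next
    show "C_k_on k (\<lambda>x. \<Sum>b\<in>Basis. (frechet_derivative h (at x) w \<bullet> b) *\<^sub>R frechet_derivative f (at (h x)) b) S" for w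
      using Suc.prems hk
      by (intro C_k_on_sum C_k_on_bilinear[OF bounded_bilinear_scaleR] C_k_on_bounded_linear_comp[OF bounded_linear_inner_left]
          assms(1) Suc.IH) simp_all
  qed
qed

lemma smooth_on_cong_open:
  "open S \<Longrightarrow> (\<And>x. x \<in> S \<Longrightarrow> f x = g x) \<Longrightarrow> smooth_on S f \<Longrightarrow> smooth_on S g"
  unfolding smooth_on_def using C_k_on_cong_open by blast

lemma smooth_on_subset: "smooth_on S f \<Longrightarrow> R \<subseteq> S \<Longrightarrow> smooth_on R f"
  unfolding smooth_on_def using C_k_on_subset by blast

lemma smooth_on_local:
  "(\<And>x. x \<in> S \<Longrightarrow> \<exists>N. open N \<and> x \<in> N \<and> smooth_on N f) \<Longrightarrow> smooth_on S f"
  unfolding smooth_on_def by (intro allI C_k_on_local) blast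

lemma smooth_on_const: "smooth_on S (\<lambda>x. c)"
  by (simp add: smooth_on_def C_k_on_const)

lemma smooth_on_ident: "open S \<Longrightarrow> smooth_on S (\<lambda>x. x)"
  by (simp add: smooth_on_def C_k_on_ident)

lemma smooth_on_add:
  "open S \<Longrightarrow> smooth_on S f \<Longrightarrow> smooth_on S g \<Longrightarrow> smooth_on S (\<lambda>x. f x + g x)"
  by (simp add: smooth_on_def C_k_on_add)

lemma smooth_on_mult:
  fixes f g :: "'e::euclidean_space \<Rightarrow> real"
  shows "open S \<Longrightarrow> smooth_on S f \<Longrightarrow> smooth_on S g \<Longrightarrow> smooth_on S (\<lambda>x. f x * g x)"
  by (simp add: smooth_on_def C_k_on_bilinear[OF bounded_bilinear_mult])

lemma smooth_on_bounded_linear_comp: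
  "bounded_linear L \<Longrightarrow> open S \<Longrightarrow> smooth_on S f \<Longrightarrow> smooth_on S (\<lambda>x. L (f x))"
  by (simp add: smooth_on_def C_k_on_bounded_linear_comp)

lemma smooth_on_compose:
  assumes "open S" "h ` S \<subseteq> R" "smooth_on S h" "smooth_on R f"
  shows "smooth_on S (\<lambda>x. f (h x))"
  using assms C_k_on_compose unfolding smooth_on_def by blast

lemma smooth_on_Pair:
  assumes "open S" "smooth_on S f" "smooth_on S g"
  shows "smooth_on S (\<lambda>x. (f x, g x))"
proof -
  have "bounded_linear (\<lambda>x::'b. (x, 0::'c))" "bounded_linear (\<lambda>x::'c. (0::'b, x))"
    by (auto intro!: bounded_linear_Pair bounded_linear_ident bounded_linear_zero)
  from smooth_on_add[OF assms(1) this[THEN smooth_on_bounded_linear_comp, OF assms(1)], OF assms(2,3)]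
  show ?thesis by simp
qed

lemma smooth_on_directional_derivative:
  "smooth_on S f \<Longrightarrow> smooth_on S (\<lambda>x. frechet_derivative f (at x) w)"
  unfolding smooth_on_def using C_k_on.simps(2) by blast

lemma smooth_on_has_derivative:
  "smooth_on S f \<Longrightarrow> x \<in> S \<Longrightarrow> (f has_derivative frechet_derivative f (at x)) (at x)"
  unfolding smooth_on_def using C_k_on_SucD by blast

lemma smooth_on_imp_continuous_on: "smooth_on S f \<Longrightarrow> continuous_on S f"
  unfolding smooth_on_def using C_k_on.simps(1) by blast

lemma segment_in_ball:
  fixes c x :: "'e::real_normed_vector"
  assumes "x \<in> ball c r" "t \<in> {0..1::real}"
  shows "c + t *\<^sub>R (x - c) \<in> ball c r"
proof -
  have "\<bar>t\<bar> * norm (x - c) \<le> 1 * norm (x - c)" using assms by (intro mult_right_mono) auto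
  then show ?thesis using assms by (simp add: dist_norm norm_minus_commute)
qed

text \<open>
  Differentiating under the integral sign turns the average of \<open>h\<close> with weight \<open>t ^ m\<close> into the average
  of a directional derivative of \<open>h\<close> with weight \<open>t ^ Suc m\<close>. The weight is there to make the
  statement stable under this step, so that an induction on \<open>k\<close> works for all \<open>m\<close> at once.
\<close>
lemma C_k_on_radial_average:
  fixes h :: "'e::euclidean_space \<Rightarrow> real"
  assumes "C_k_on k h (ball c r)"
  shows "C_k_on k (\<lambda>x. integral (cbox 0 1) (\<lambda>t. t ^ m * h (c + t *\<^sub>R (x - c)))) (ball c r)"
  using assms
proof (induction k arbitrary: h m)
  case 0
  have "continuous_on (ball c r \<times> cbox 0 1) (\<lambda>(x, t::real). h (c + t *\<^sub>R (x - c)))"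
    unfolding case_prod_beta using segment_in_ball[of _ c r]
    by (intro continuous_on_compose2[OF C_k_on_imp_continuous_on[OF "0.prems"]] continuous_intros) (auto simp del: mem_ball)
  then have "continuous_on (ball c r \<times> cbox 0 1) (\<lambda>(x, t). t ^ m * h (c + t *\<^sub>R (x - c)))"
    unfolding case_prod_beta by (intro continuous_intros)
  from integral_continuous_on_param[OF this] show ?case unfolding C_k_on.simps .
next
  case (Suc k)
  let ?D = "\<lambda>b x. frechet_derivative h (at x) b"
  let ?seg = "\<lambda>x t::real. c + t *\<^sub>R (x - c)"
  define L where "L x t = (\<Sum>b\<in>Basis. (t ^ Suc m * ?D b (?seg x t)) *\<^sub>R blinfun_inner_left b)" for x t
  have seg: "?seg x t \<in> ball c r" if "x \<in> ball c r" "t \<in> cbox 0 1" for x t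
    using segment_in_ball that by auto
  have cD: "continuous_on (ball c r) (?D b)" for b
    using Suc.prems by (auto intro: C_k_on_imp_continuous_on)
  have L_apply: "blinfun_apply (L x t) w = t ^ Suc m * ?D w (?seg x t)" if "x \<in> ball c r" "t \<in> cbox 0 1" for x t w
  proof -
    have "?D w (?seg x t) = (\<Sum>b\<in>Basis. (w \<bullet> b) * ?D b (?seg x t))"
      using has_derivative_Basis_expansion[OF C_k_on_SucD[OF Suc.prems seg[OF that]], of w] by simp
    then show ?thesis
      by (simp add: L_def blinfun.sum_left blinfun.scaleR_left sum_distrib_left inner_commute mult_ac)
  qed
  have Lc: "continuous_on (ball c r \<times> cbox 0 1) (\<lambda>(x, t). L x t)"
    unfolding L_def case_prod_beta using seg
    by (intro continuous_intros continuous_on_compose2[OF cD]) auto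
  have der: "((\<lambda>x. integral (cbox 0 1) (\<lambda>t. t ^ m * h (?seg x t))) has_derivative
      blinfun_apply (integral (cbox 0 1) (L x))) (at x)" if x: "x \<in> ball c r" for x
  proof -
    have "((\<lambda>x. integral (cbox 0 1) (\<lambda>t. t ^ m * h (?seg x t))) has_derivative
      blinfun_apply (integral (cbox 0 1) (L x))) (at x within ball c r)"
    proof (rule leibniz_rule[OF _ _ Lc x convex_ball])
      fix y t assume y: "y \<in> ball c r" "t \<in> cbox (0::real) 1"
      have "((\<lambda>y. h (?seg y t)) has_derivative (\<lambda>w. ?D (t *\<^sub>R w) (?seg y t))) (at y)"
        by (rule has_derivative_compose[where g = h and f = "\<lambda>y. ?seg y t", OF _ C_k_on_SucD[OF Suc.prems seg[OF y]]])
          (auto intro!: derivative_eq_intros)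
      from has_derivative_mult_right[OF this, of "t ^ m"]
      have "((\<lambda>y. t ^ m * h (?seg y t)) has_derivative (\<lambda>w. t ^ m * ?D (t *\<^sub>R w) (?seg y t))) (at y)" .
      moreover have "(\<lambda>w. t ^ m * ?D (t *\<^sub>R w) (?seg y t)) = blinfun_apply (L y t)"
        by (simp add: fun_eq_iff L_apply[OF y]
            linear_cmul[OF has_derivative_linear[OF C_k_on_SucD[OF Suc.prems seg[OF y]]]])
      ultimately show "((\<lambda>y. t ^ m * h (?seg y t)) has_derivative blinfun_apply (L y t)) (at y within ball c r)"
        using has_derivative_at_withinI by metis
    next
      fix y assume y: "y \<in> ball c r"
      show "(\<lambda>t. t ^ m * h (?seg y t)) integrable_on cbox 0 1"
        using seg[OF y] by (intro integrable_continuous continuous_intros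
            continuous_on_compose2[OF C_k_on_imp_continuous_on[OF Suc.prems]]) auto
    qed
    then show ?thesis using x by (simp add: at_within_open[OF _ open_ball])
  qed
  have Lint: "L x integrable_on cbox 0 1" if "x \<in> ball c r" for x
  proof (rule integrable_continuous)
    have "continuous_on (cbox 0 1) (\<lambda>t. case (x, t) of (x, t) \<Rightarrow> L x t)"
      by (rule continuous_on_compose2[OF Lc]) (use that in \<open>auto intro!: continuous_intros\<close>)
    then show "continuous_on (cbox 0 1) (L x)" by simp
  qed
  have int: "blinfun_apply (integral (cbox 0 1) (L x)) w =
      integral (cbox 0 1) (\<lambda>t. t ^ Suc m * ?D w (?seg x t))" if "x \<in> ball c r" for x w
    unfolding blinfun_apply_integral[OF Lint[OF that]]
    by (rule integral_cong) (simp add: L_apply[OF that])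
  show ?case
    by (rule C_k_on_SucI[OF open_ball der], assumption)
      (rule C_k_on_cong_open[OF open_ball int[symmetric] Suc.IH], assumption, use Suc.prems in simp)
qed

text \<open>
  Integrate the derivative of \<open>h\<close> along the segment from \<open>c\<close> to \<open>x\<close>: the cofactor \<open>G b\<close> is the average of the
  partial derivative in direction \<open>b\<close> over that segment.
\<close>
lemma Hadamard:
  fixes h :: "'e::euclidean_space \<Rightarrow> real"
  assumes "smooth_on (ball c r) h"
  obtains G where "\<And>b. smooth_on (ball c r) (G b)"
    and "\<And>b. G b c = frechet_derivative h (at c) b"
    and "\<And>x. x \<in> ball c r \<Longrightarrow> h x = h c + (\<Sum>b\<in>Basis. ((x - c) \<bullet> b) * G b x)"
proof
  let ?D = "\<lambda>b x. frechet_derivative h (at x) b"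
  let ?seg = "\<lambda>x t::real. c + t *\<^sub>R (x - c)"
  let ?G = "\<lambda>b x. integral (cbox 0 1) (\<lambda>t. ?D b (?seg x t))"
  show "smooth_on (ball c r) (?G b)" for b
    using C_k_on_radial_average[of _ "?D b" c r 0] smooth_on_directional_derivative[OF assms]
    unfolding smooth_on_def by simp
  show "?G b c = ?D b c" for b by simp
  fix x assume x: "x \<in> ball c r"
  have seg: "?seg x t \<in> ball c r" if "t \<in> cbox 0 1" for t
    using segment_in_ball[OF x] that by auto
  have cont: "continuous_on (cbox 0 1) (\<lambda>t. ?D b (?seg x t))" for b
    using seg by (intro continuous_on_compose2[OF
        smooth_on_imp_continuous_on[OF smooth_on_directional_derivative[OF assms]]] continuous_intros) auto
  have "((\<lambda>t. ?D (x - c) (?seg x t)) has_integral h (?seg x 1) - h (?seg x 0)) {0..1}"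
  proof (rule fundamental_theorem_of_calculus)
    fix t :: real assume "t \<in> {0..1}"
    then have d: "(h has_derivative frechet_derivative h (at (?seg x t))) (at (?seg x t))"
      using seg smooth_on_has_derivative[OF assms] by auto
    have "((\<lambda>t. h (?seg x t)) has_derivative (\<lambda>s. ?D (s *\<^sub>R (x - c)) (?seg x t))) (at t)"
      by (rule has_derivative_compose[where g = h and f = "?seg x", OF _ d]) (auto intro!: derivative_eq_intros)
    then show "((\<lambda>t. h (?seg x t)) has_vector_derivative ?D (x - c) (?seg x t)) (at t within {0..1})"
      using linear_cmul[OF has_derivative_linear[OF d]]
      by (simp add: has_vector_derivative_def has_derivative_at_withinI)
  qed simp
  then have "h x - h c = integral (cbox 0 1) (\<lambda>t. ?D (x - c) (?seg x t))"
    by (simp add: integral_unique)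
  also have "\<dots> = integral (cbox 0 1) (\<lambda>t. \<Sum>b\<in>Basis. ((x - c) \<bullet> b) * ?D b (?seg x t))"
    by (intro integral_cong) (simp add: has_derivative_Basis_expansion[OF smooth_on_has_derivative[OF assms seg], of _ "x - c"])
  also have "\<dots> = (\<Sum>b\<in>Basis. integral (cbox 0 1) (\<lambda>t. ((x - c) \<bullet> b) * ?D b (?seg x t)))"
    using cont by (intro integral_sum integrable_continuous continuous_intros) auto
  finally show "h x = h c + (\<Sum>b\<in>Basis. ((x - c) \<bullet> b) * ?G b x)" by simp
qed

section \<open>Tangent vectors and vector fields\<close>

context smooth_manifold
begin

lemma chart_subset: "(U, \<phi>) \<in> A \<Longrightarrow> U \<subseteq> topspace T"
  using charts openin_subset by blast

lemma chart_inj: assumes "(U, \<phi>) \<in> A" shows "inj_on \<phi> U"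
proof -
  have "homeomorphic_map (subtopology T U) (top_of_set (\<phi> ` U)) \<phi>"
    using charts[OF assms] by blast
  from homeomorphic_imp_injective_map[OF this] show ?thesis
    using chart_subset[OF assms] by (simp add: Int_absorb1)
qed

lemma chart_inverse [simp]: "(U, \<phi>) \<in> A \<Longrightarrow> p \<in> U \<Longrightarrow> inv_into U \<phi> (\<phi> p) = p"
  using chart_inj by simp

lemma chart_image_open:
  assumes "(U, \<phi>) \<in> A" "openin T W" shows "open (\<phi> ` (U \<inter> W))"
proof -
  have "openin (subtopology T U) (U \<inter> W)"
    using assms charts openin_subtopology_Int2 by blast
  then have "openin (top_of_set (\<phi> ` U)) (\<phi> ` (U \<inter> W))"
    using charts[OF assms(1)] homeomorphic_imp_open_map open_map_def by blast
  then show ?thesis using charts[OF assms(1)] openin_open_trans by blast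
qed

lemma chart_preimage_open:
  assumes "(U, \<phi>) \<in> A" "open S" shows "openin T {p \<in> U. \<phi> p \<in> S}"
proof -
  have c: "continuous_map (subtopology T U) (top_of_set (\<phi> ` U)) \<phi>"
    using charts[OF assms(1)] homeomorphic_imp_continuous_map by blast
  have "openin (top_of_set (\<phi> ` U)) (\<phi> ` U \<inter> S)" using assms(2) by blast
  from openin_continuous_map_preimage[OF c this]
  moreover have "{x \<in> topspace (subtopology T U). \<phi> x \<in> \<phi> ` U \<inter> S} = {p \<in> U. \<phi> p \<in> S}"
    using chart_subset[OF assms(1)] by auto
  ultimately have "openin (subtopology T U) {p \<in> U. \<phi> p \<in> S}" by (simp only:)
  then show ?thesis using charts[OF assms(1)] openin_trans_full by blast
qed

lemma chart_at: assumes "p \<in> topspace T" obtains U \<phi> where "(U, \<phi>) \<in> A" "p \<in> U"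
proof -
  have "p \<in> (\<Union>(U, \<phi>)\<in>A. U)" using assms charts_cover by simp
  then show thesis using that by auto
qed

lemma smooth_fun_onD:
  "smooth_fun_on W f \<Longrightarrow> (U, \<phi>) \<in> A \<Longrightarrow> smooth_on (\<phi> ` (U \<inter> W)) (\<lambda>x. f (inv_into U \<phi> x))"
  unfolding smooth_fun_on_def comp_def by blast

lemma smooth_fun_onI:
  "(\<And>U \<phi>. (U, \<phi>) \<in> A \<Longrightarrow> smooth_on (\<phi> ` (U \<inter> W)) (\<lambda>x. f (inv_into U \<phi> x))) \<Longrightarrow> smooth_fun_on W f"
  unfolding smooth_fun_on_def comp_def by blast

lemma smooth_fun_on_subset: "smooth_fun_on W f \<Longrightarrow> W' \<subseteq> W \<Longrightarrow> smooth_fun_on W' f"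
  by (rule smooth_fun_onI, rule smooth_on_subset, erule smooth_fun_onD) auto

lemma smooth_near_imp_topspace: "smooth_near p f \<Longrightarrow> p \<in> topspace T"
  unfolding smooth_near_def using openin_subset by blast

lemma smooth_nearI: "smooth_fun_on W f \<Longrightarrow> openin T W \<Longrightarrow> p \<in> W \<Longrightarrow> smooth_near p f"
  unfolding smooth_near_def by blast

lemma smooth_fun_onI_near:
  assumes "\<And>p. p \<in> W \<Longrightarrow> smooth_near p f" shows "smooth_fun_on W f"
  unfolding smooth_fun_on_def
proof clarify
  fix U \<phi> assume ch: "(U, \<phi>) \<in> A"
  show "smooth_on (\<phi> ` (U \<inter> W)) (f \<circ> inv_into U \<phi>)"
  proof (rule smooth_on_local)
    fix x assume "x \<in> \<phi> ` (U \<inter> W)"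
    then obtain p where p: "p \<in> U" "p \<in> W" "x = \<phi> p" by blast
    then obtain W' where W': "openin T W'" "p \<in> W'" "smooth_fun_on W' f"
      using assms unfolding smooth_near_def by blast
    have "smooth_on (\<phi> ` (U \<inter> W')) (f \<circ> inv_into U \<phi>)"
      using W'(3) ch unfolding smooth_fun_on_def by blast
    then show "\<exists>N. open N \<and> x \<in> N \<and> smooth_on N (f \<circ> inv_into U \<phi>)"
      using chart_image_open[OF ch W'(1)] p W'(2) by blast
  qed
qed

text \<open>
  By compatibility of the charts, smoothness in one chart around \<open>p\<close> suffices.
\<close>
lemma smooth_near_chartI:
  assumes ch: "(U, \<phi>) \<in> A" and p: "p \<in> U" "p \<in> W" and W: "openin T W"
    and f: "smooth_on (\<phi> ` (U \<inter> W)) (f \<circ> inv_into U \<phi>)"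
  shows "smooth_near p f"
proof (rule smooth_nearI)
  show UW: "openin T (U \<inter> W)" using charts[OF ch] W by blast
  show "p \<in> U \<inter> W" using p by blast
  show "smooth_fun_on (U \<inter> W) f"
    unfolding smooth_fun_on_def
  proof clarify
    fix V \<psi> assume ch': "(V, \<psi>) \<in> A"
    have o: "open (\<psi> ` (V \<inter> (U \<inter> W)))" by (rule chart_image_open[OF ch' UW])
    have t: "smooth_on (\<psi> ` (V \<inter> (U \<inter> W))) (\<phi> \<circ> inv_into V \<psi>)"
      by (rule smooth_on_subset[OF charts_compatible[OF ch' ch]]) blast
    have "smooth_on (\<psi> ` (V \<inter> (U \<inter> W))) (\<lambda>x. (f \<circ> inv_into U \<phi>) ((\<phi> \<circ> inv_into V \<psi>) x))"
      by (rule smooth_on_compose[OF o _ t f]) (use ch' in auto)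
    then show "smooth_on (\<psi> ` (V \<inter> (U \<inter> W))) (f \<circ> inv_into V \<psi>)"
      by (rule smooth_on_cong_open[OF o, rotated]) (use ch ch' in auto)
  qed
qed

lemma smooth_on_chart_near:
  assumes ch: "(U, \<phi>) \<in> A" and p: "p \<in> U" and h: "open S" "\<phi> p \<in> S" "smooth_on S h"
  shows "smooth_near p (\<lambda>q. h (\<phi> q))"
proof (rule smooth_near_chartI[OF ch p])
  let ?W = "{q \<in> U. \<phi> q \<in> S}"
  show W: "openin T ?W" by (rule chart_preimage_open[OF ch h(1)])
  show "p \<in> ?W" using p h(2) by simp
  show "smooth_on (\<phi> ` (U \<inter> ?W)) ((\<lambda>q. h (\<phi> q)) \<circ> inv_into U \<phi>)"
    by (rule smooth_on_cong_open[OF chart_image_open[OF ch W] _ smooth_on_subset[OF h(3)]]) (use ch in auto)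
qed

lemma smooth_near_obtain_chart:
  assumes "smooth_near p f" "(U, \<phi>) \<in> A" "p \<in> U"
  obtains W where "openin T W" "p \<in> W" "W \<subseteq> U" "open (\<phi> ` W)" "smooth_on (\<phi> ` W) (f \<circ> inv_into U \<phi>)"
proof -
  obtain W where W: "openin T W" "p \<in> W" "smooth_fun_on W f"
    using assms(1) unfolding smooth_near_def by blast
  show thesis
  proof (rule that[of "U \<inter> W"])
    show "openin T (U \<inter> W)" using W charts[OF assms(2)] by blast
    show "smooth_on (\<phi> ` (U \<inter> W)) (f \<circ> inv_into U \<phi>)"
      using W assms unfolding smooth_fun_on_def by blast
  qed (use W assms chart_image_open[OF assms(2)] in auto)
qed

lemma smooth_near_chart_derivative:
  assumes "smooth_near p f" "(U, \<phi>) \<in> A" "p \<in> U"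
  shows "((f \<circ> inv_into U \<phi>) has_derivative frechet_derivative (f \<circ> inv_into U \<phi>) (at (\<phi> p))) (at (\<phi> p))"
proof (rule smooth_near_obtain_chart[OF assms])
  fix W assume "p \<in> W" "smooth_on (\<phi> ` W) (f \<circ> inv_into U \<phi>)"
  then show ?thesis by (intro smooth_on_has_derivative) auto
qed

lemma smooth_near_cong:
  assumes "smooth_near p f" "openin T W" "p \<in> W" "\<And>q. q \<in> W \<Longrightarrow> f q = h q"
  shows "smooth_near p h"
proof -
  obtain U \<phi> where ch: "(U, \<phi>) \<in> A" "p \<in> U"
    by (rule chart_at[OF smooth_near_imp_topspace[OF assms(1)]])
  obtain W' where W': "openin T W'" "p \<in> W'" "W' \<subseteq> U" "smooth_on (\<phi> ` W') (f \<circ> inv_into U \<phi>)"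
    by (rule smooth_near_obtain_chart[OF assms(1) ch])
  have WW: "openin T (W \<inter> W')" by (rule openin_Int[OF assms(2) W'(1)])
  have s: "smooth_on (\<phi> ` (U \<inter> (W \<inter> W'))) (f \<circ> inv_into U \<phi>)"
    by (rule smooth_on_subset[OF W'(4)]) blast
  have "smooth_on (\<phi> ` (U \<inter> (W \<inter> W'))) (h \<circ> inv_into U \<phi>)"
  proof (rule smooth_on_cong_open[OF chart_image_open[OF ch(1) WW] _ s])
    fix x assume "x \<in> \<phi> ` (U \<inter> (W \<inter> W'))"
    then obtain q where "q \<in> U" "q \<in> W" "x = \<phi> q" by blast
    then show "(f \<circ> inv_into U \<phi>) x = (h \<circ> inv_into U \<phi>) x"
      using assms(4) ch(1) by simp
  qed
  then show ?thesis by (rule smooth_near_chartI[OF ch IntI[OF assms(3) W'(2)] WW])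
qed

lemma smooth_fun_on_const: "smooth_fun_on W (\<lambda>q. c)"
  by (rule smooth_fun_onI) (rule smooth_on_const)

lemma smooth_near_const: "p \<in> topspace T \<Longrightarrow> smooth_near p (\<lambda>q. c)"
  by (rule smooth_nearI[OF smooth_fun_on_const openin_topspace])

lemma smooth_near_common:
  assumes "smooth_near p f" "smooth_near p h"
  obtains W where "openin T W" "p \<in> W" "smooth_fun_on W f" "smooth_fun_on W h"
proof -
  obtain W W' where W: "openin T W" "p \<in> W" "smooth_fun_on W f" "openin T W'" "p \<in> W'" "smooth_fun_on W' h"
    using assms unfolding smooth_near_def by blast
  show thesis
  proof (rule that)
    show "smooth_fun_on (W \<inter> W') f" "smooth_fun_on (W \<inter> W') h"
      by (rule smooth_fun_on_subset[OF W(3)], blast) (rule smooth_fun_on_subset[OF W(6)], blast)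
  qed (use W in auto)
qed

lemma smooth_fun_on_add:
  "openin T W \<Longrightarrow> smooth_fun_on W f \<Longrightarrow> smooth_fun_on W h \<Longrightarrow> smooth_fun_on W (\<lambda>q. f q + h q)"
  by (rule smooth_fun_onI, rule smooth_on_add[OF chart_image_open smooth_fun_onD smooth_fun_onD])

lemma smooth_fun_on_mult:
  "openin T W \<Longrightarrow> smooth_fun_on W f \<Longrightarrow> smooth_fun_on W h \<Longrightarrow> smooth_fun_on W (\<lambda>q. f q * h q)"
  by (rule smooth_fun_onI, rule smooth_on_mult[OF chart_image_open smooth_fun_onD smooth_fun_onD])

lemma smooth_fun_on_sum:
  assumes "openin T W" "\<And>i. i \<in> I \<Longrightarrow> smooth_fun_on W (f i)"
  shows "smooth_fun_on W (\<lambda>q. \<Sum>i\<in>I. f i q)"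
  using assms(2)
  by (induction I rule: infinite_finite_induct)
    (simp_all add: smooth_fun_on_const smooth_fun_on_add[OF assms(1)])

lemma smooth_fun_on_topspace_near: "smooth_fun_on (topspace T) f \<Longrightarrow> p \<in> topspace T \<Longrightarrow> smooth_near p f"
  by (rule smooth_nearI[OF _ openin_topspace])

lemma smooth_near_add: "smooth_near p f \<Longrightarrow> smooth_near p h \<Longrightarrow> smooth_near p (\<lambda>q. f q + h q)"
  by (erule (1) smooth_near_common) (rule smooth_nearI[OF smooth_fun_on_add])

lemma smooth_near_mult: "smooth_near p f \<Longrightarrow> smooth_near p h \<Longrightarrow> smooth_near p (\<lambda>q. f q * h q)"
  by (erule (1) smooth_near_common) (rule smooth_nearI[OF smooth_fun_on_mult])

lemma smooth_near_lincomb: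
  assumes "smooth_near p f" "smooth_near p h"
  shows "smooth_near p (\<lambda>q. a * f q + b * h q)"
  using assms smooth_near_imp_topspace[OF assms(1)]
  by (intro smooth_near_add smooth_near_mult smooth_near_const)

lemma smooth_near_sum:
  assumes "p \<in> topspace T" "\<And>i. i \<in> I \<Longrightarrow> smooth_near p (f i)"
  shows "smooth_near p (\<lambda>q. \<Sum>i\<in>I. f i q)"
  using assms(2)
  by (induction I rule: infinite_finite_induct) (simp_all add: smooth_near_const smooth_near_add assms(1))

lemma tangent_not_smooth:
  assumes "v \<in> tangent_space p" "\<not> smooth_near p f" shows "v f = 0"
proof -
  have "\<forall>f. \<not> smooth_near p f \<longrightarrow> v f = 0"
    using assms(1) unfolding tangent_space_def mem_Collect_eq by (elim conjE)
  then show ?thesis using assms(2) by blast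
qed

lemma tangent_lincomb:
  assumes "v \<in> tangent_space p" "smooth_near p f" "smooth_near p h"
  shows "v (\<lambda>x. a * f x + b * h x) = a * v f + b * v h"
proof -
  have "\<forall>f h a b. smooth_near p f \<and> smooth_near p h \<longrightarrow>
      v (\<lambda>x. a * f x + b * h x) = a * v f + b * v h"
    using assms(1) unfolding tangent_space_def mem_Collect_eq by (elim conjE)
  from this[rule_format, OF conjI, OF assms(2,3)] show ?thesis .
qed

lemma tangent_mult:
  assumes "v \<in> tangent_space p" "smooth_near p f" "smooth_near p h"
  shows "v (\<lambda>x. f x * h x) = v f * h p + f p * v h"
proof -
  have "\<forall>f h. smooth_near p f \<and> smooth_near p h \<longrightarrow>
      v (\<lambda>x. f x * h x) = v f * h p + f p * v h"
    using assms(1) unfolding tangent_space_def mem_Collect_eq by (elim conjE)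
  from this[rule_format, OF conjI, OF assms(2,3)] show ?thesis .
qed

lemma tangent_add:
  "v \<in> tangent_space p \<Longrightarrow> smooth_near p f \<Longrightarrow> smooth_near p h \<Longrightarrow>
   v (\<lambda>x. f x + h x) = v f + v h"
  using tangent_lincomb[of v p f h 1 1] by simp

text \<open>
  Derivations depend only on germs: \<open>f - h\<close> vanishes at \<open>p\<close> and its product with the indicator of \<open>W\<close> is
  zero, while the Leibniz rule evaluates the derivation on that product to \<open>v f - v h\<close>.
\<close>
lemma tangent_local:
  assumes v: "v \<in> tangent_space p" and f: "smooth_near p f"
    and W: "openin T W" "p \<in> W" "\<And>q. q \<in> W \<Longrightarrow> f q = h q"
  shows "v f = v h"
proof -
  have p: "p \<in> topspace T" using f by (rule smooth_near_imp_topspace)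
  have h: "smooth_near p h" by (rule smooth_near_cong[OF f W])
  \<comment> \<open>The difference is written as a linear combination, the form in which derivations are linear.\<close>
  have d: "smooth_near p (\<lambda>q. 1 * f q + (-1) * h q)" by (rule smooth_near_lincomb[OF f h])
  have i: "smooth_near p (indicator W)"
    by (rule smooth_near_cong[OF smooth_near_const[OF p, of 1] W(1,2)]) simp
  have "(\<lambda>q. (1 * f q + (-1) * h q) * indicator W q) = (\<lambda>q. 0 * f q + 0 * f q)"
  proof
    fix q show "(1 * f q + (-1) * h q) * indicator W q = 0 * f q + 0 * f q"
      using W(3)[of q] by (cases "q \<in> W") simp_all
  qed
  then have "v (\<lambda>q. (1 * f q + (-1) * h q) * indicator W q) = 0 * v f + 0 * v f"
    by (simp only: tangent_lincomb[OF v f f])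
  moreover have "v (\<lambda>q. (1 * f q + (-1) * h q) * indicator W q) = (1 * v f + (-1) * v h) * 1 + 0"
    unfolding tangent_mult[OF v d i] tangent_lincomb[OF v f h] using W by simp
  ultimately show ?thesis by simp
qed

lemma tangent_const:
  assumes "v \<in> tangent_space p" shows "v (\<lambda>q. c) = 0"
proof (cases "p \<in> topspace T")
  case True
  note s = smooth_near_const[OF True]
  have "v (\<lambda>q. 1) = 0" using tangent_mult[OF assms s s, of 1 1] by simp
  then show ?thesis using tangent_lincomb[OF assms s s, of c 1 0 1] by simp
next
  case False
  then show ?thesis by (intro tangent_not_smooth[OF assms] notI) (drule smooth_near_imp_topspace, simp)
qed

lemma tangent_locally_const:
  assumes "v \<in> tangent_space p" "p \<in> topspace T" "\<And>q. q \<in> topspace T \<Longrightarrow> f q = c"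
  shows "v f = 0"
proof -
  have "v (\<lambda>q. c) = v f"
    by (rule tangent_local[OF assms(1) smooth_near_const[OF assms(2)] openin_topspace assms(2)]) (simp add: assms(3))
  then show ?thesis using tangent_const[OF assms(1)] by simp
qed

lemma tangent_sum:
  assumes v: "v \<in> tangent_space p" and "p \<in> topspace T" "\<And>i. i \<in> I \<Longrightarrow> smooth_near p (f i)"
  shows "v (\<lambda>q. \<Sum>i\<in>I. f i q) = (\<Sum>i\<in>I. v (f i))"
  using assms(3)
proof (induction I rule: infinite_finite_induct)
  case (insert i I)
  then show ?case
    using tangent_add[OF v, of "f i" "\<lambda>q. \<Sum>i\<in>I. f i q"] smooth_near_sum[OF assms(2), of I f] by simp
qed (simp_all add: tangent_const[OF v])

lemma tangent_space_sum:
  assumes "\<And>i. i \<in> I \<Longrightarrow> u i \<in> tangent_space p"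
  shows "(\<lambda>f. \<Sum>i\<in>I. c i * u i f) \<in> tangent_space p"
  unfolding tangent_space_def mem_Collect_eq
proof (intro conjI allI impI)
  show "(\<Sum>i\<in>I. c i * u i f) = 0" if "\<not> smooth_near p f" for f
    using tangent_not_smooth[OF assms that] by simp
  show "(\<Sum>i\<in>I. c i * u i (\<lambda>x. a * f x + b * h x)) = a * (\<Sum>i\<in>I. c i * u i f) + b * (\<Sum>i\<in>I. c i * u i h)"
    if "smooth_near p f \<and> smooth_near p h" for f h a b
  proof -
    have "(\<Sum>i\<in>I. c i * u i (\<lambda>x. a * f x + b * h x)) = (\<Sum>i\<in>I. a * (c i * u i f) + b * (c i * u i h))"
    proof (rule sum.cong[OF refl])
      fix i assume "i \<in> I"
      from tangent_lincomb[OF assms[OF this] conjunct1[OF that] conjunct2[OF that]]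
      show "c i * u i (\<lambda>x. a * f x + b * h x) = a * (c i * u i f) + b * (c i * u i h)"
        by (simp add: distrib_left)
    qed
    then show ?thesis by (simp add: sum.distrib sum_distrib_left)
  qed
  show "(\<Sum>i\<in>I. c i * u i (\<lambda>x. f x * h x)) = (\<Sum>i\<in>I. c i * u i f) * h p + f p * (\<Sum>i\<in>I. c i * u i h)"
    if "smooth_near p f \<and> smooth_near p h" for f h
  proof -
    have "(\<Sum>i\<in>I. c i * u i (\<lambda>x. f x * h x)) = (\<Sum>i\<in>I. (c i * u i f) * h p + f p * (c i * u i h))"
    proof (rule sum.cong[OF refl])
      fix i assume "i \<in> I"
      from tangent_mult[OF assms[OF this] conjunct1[OF that] conjunct2[OF that]]
      show "c i * u i (\<lambda>x. f x * h x) = (c i * u i f) * h p + f p * (c i * u i h)"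
        by (simp add: distrib_left)
    qed
    then show ?thesis by (simp add: sum.distrib sum_distrib_left sum_distrib_right)
  qed
qed

lemma tangent_space_zero: "(\<lambda>f. 0) \<in> tangent_space p"
  using tangent_space_sum[of "{}"] by simp

definition chart_derivation :: "'a set \<Rightarrow> ('a \<Rightarrow> 'e) \<Rightarrow> 'a \<Rightarrow> 'e \<Rightarrow> 'a tangent_vector" where
  "chart_derivation U \<phi> p w =
     (\<lambda>f. if smooth_near p f then frechet_derivative (f \<circ> inv_into U \<phi>) (at (\<phi> p)) w else 0)"

lemma chart_derivation_eq:
  assumes "((f \<circ> inv_into U \<phi>) has_derivative D) (at (\<phi> p))" "smooth_near p f"
  shows "chart_derivation U \<phi> p w f = D w"
  using assms frechet_derivative_at[OF assms(1)] by (simp add: chart_derivation_def)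

lemma chart_derivation_tangent:
  assumes ch: "(U, \<phi>) \<in> A" "p \<in> U"
  shows "chart_derivation U \<phi> p w \<in> tangent_space p"
  unfolding tangent_space_def mem_Collect_eq
proof (intro conjI allI impI; (elim conjE)?)
  fix f assume "\<not> smooth_near p f"
  then show "chart_derivation U \<phi> p w f = 0" by (simp add: chart_derivation_def)
next
  fix f h a b assume fh: "smooth_near p f" "smooth_near p h"
  have d: "((\<lambda>x. a * f x + b * h x) \<circ> inv_into U \<phi> has_derivative
      (\<lambda>w. a * frechet_derivative (f \<circ> inv_into U \<phi>) (at (\<phi> p)) w +
           b * frechet_derivative (h \<circ> inv_into U \<phi>) (at (\<phi> p)) w)) (at (\<phi> p))"
    using has_derivative_add[OF has_derivative_mult_right[OF smooth_near_chart_derivative[OF fh(1) ch], of a]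
        has_derivative_mult_right[OF smooth_near_chart_derivative[OF fh(2) ch], of b]]
    by (simp add: comp_def)
  show "chart_derivation U \<phi> p w (\<lambda>x. a * f x + b * h x) =
      a * chart_derivation U \<phi> p w f + b * chart_derivation U \<phi> p w h"
    unfolding chart_derivation_eq[OF d smooth_near_lincomb[OF fh]]
    using fh by (simp add: chart_derivation_def)
next
  fix f h assume fh: "smooth_near p f" "smooth_near p h"
  have d: "((\<lambda>x. f x * h x) \<circ> inv_into U \<phi> has_derivative
      (\<lambda>w. f p * frechet_derivative (h \<circ> inv_into U \<phi>) (at (\<phi> p)) w +
           frechet_derivative (f \<circ> inv_into U \<phi>) (at (\<phi> p)) w * h p)) (at (\<phi> p))"
    using has_derivative_mult[OF smooth_near_chart_derivative[OF fh(1) ch] smooth_near_chart_derivative[OF fh(2) ch]]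
    using ch by (simp add: comp_def)
  show "chart_derivation U \<phi> p w (\<lambda>x. f x * h x) =
      chart_derivation U \<phi> p w f * h p + f p * chart_derivation U \<phi> p w h"
    unfolding chart_derivation_eq[OF d smooth_near_mult[OF fh]]
    using fh by (simp add: chart_derivation_def)
qed

lemma chart_derivation_lincomb:
  assumes ch: "(U, \<phi>) \<in> A" "p \<in> U"
  shows "chart_derivation U \<phi> p (a *\<^sub>R w + b *\<^sub>R w') =
    (\<lambda>f. a * chart_derivation U \<phi> p w f + b * chart_derivation U \<phi> p w' f)"
proof
  fix f
  show "chart_derivation U \<phi> p (a *\<^sub>R w + b *\<^sub>R w') f =
    a * chart_derivation U \<phi> p w f + b * chart_derivation U \<phi> p w' f"
  proof (cases "smooth_near p f")
    case True
    then show ?thesis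
      using has_derivative_linear[OF smooth_near_chart_derivative[OF True ch]]
      by (simp add: chart_derivation_def linear_add linear_cmul)
  qed (simp add: chart_derivation_def)
qed

lemma smooth_near_coordinate:
  assumes ch: "(U, \<phi>) \<in> A" "p \<in> U"
  shows "smooth_near p (\<lambda>q. \<phi> q \<bullet> b)"
  by (rule smooth_on_chart_near[OF ch open_UNIV, of "\<lambda>x. x \<bullet> b"])
    (auto intro!: smooth_on_bounded_linear_comp[OF bounded_linear_inner_left] smooth_on_ident)

lemma chart_derivation_coordinate:
  assumes ch: "(U, \<phi>) \<in> A" "p \<in> U"
  shows "chart_derivation U \<phi> p w (\<lambda>q. \<phi> q \<bullet> b) = w \<bullet> b"
proof (rule chart_derivation_eq[OF _ smooth_near_coordinate[OF ch]])
  have o: "open (\<phi> ` U)" using charts[OF ch(1)] by blast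
  have "((\<lambda>x. x \<bullet> b) has_derivative (\<lambda>w. w \<bullet> b)) (at (\<phi> p))"
    by (auto intro!: derivative_eq_intros)
  then show "((\<lambda>q. \<phi> q \<bullet> b) \<circ> inv_into U \<phi> has_derivative (\<lambda>w. w \<bullet> b)) (at (\<phi> p))"
    by (rule has_derivative_transform_within_open[OF _ o]) (use ch in auto)
qed

text \<open>
  Hadamard's lemma writes \<open>f\<close> near \<open>p\<close> as a constant plus a sum of products of a centred coordinate
  and a smooth function. The Leibniz rule then determines \<open>v f\<close> from the values of \<open>v\<close> on the
  coordinates, as the centred coordinates vanish at \<open>p\<close>.
\<close>
lemma tangent_eq_chart_derivation:
  assumes ch: "(U, \<phi>) \<in> A" "p \<in> U" and v: "v \<in> tangent_space p"
  shows "v = chart_derivation U \<phi> p (\<Sum>b\<in>Basis. v (\<lambda>q. \<phi> q \<bullet> b) *\<^sub>R b)"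
proof
  fix f
  show "v f = chart_derivation U \<phi> p (\<Sum>b\<in>Basis. v (\<lambda>q. \<phi> q \<bullet> b) *\<^sub>R b) f"
  proof (cases "smooth_near p f")
    case False
    then show ?thesis using tangent_not_smooth[OF v] by (simp add: chart_derivation_def)
  next
    case f: True
    let ?h = "f \<circ> inv_into U \<phi>"
    let ?c = "\<phi> p"
    have p: "p \<in> topspace T" using f by (rule smooth_near_imp_topspace)
    obtain W where W: "openin T W" "p \<in> W" "W \<subseteq> U" "open (\<phi> ` W)" "smooth_on (\<phi> ` W) ?h"
      by (rule smooth_near_obtain_chart[OF f ch])
    then obtain r where r: "r > 0" "ball ?c r \<subseteq> \<phi> ` W"
      by (meson imageI open_contains_ball)
    obtain G where G: "\<And>b. smooth_on (ball ?c r) (G b)" "\<And>b. G b ?c = frechet_derivative ?h (at ?c) b"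
      and hG: "\<And>x. x \<in> ball ?c r \<Longrightarrow> ?h x = ?h ?c + (\<Sum>b\<in>Basis. ((x - ?c) \<bullet> b) * G b x)"
      by (rule Hadamard[OF smooth_on_subset[OF W(5) r(2)]]) blast
    have Gs: "smooth_near p (\<lambda>q. G b (\<phi> q))" for b
      by (rule smooth_on_chart_near[OF ch open_ball _ G(1)]) (use r in simp)
    have cs: "smooth_near p (\<lambda>q. 1 * (\<phi> q \<bullet> b) + (- (?c \<bullet> b)) * 1)" for b
      by (rule smooth_near_lincomb[OF smooth_near_coordinate[OF ch] smooth_near_const[OF p]])
    let ?t = "\<lambda>b q. (1 * (\<phi> q \<bullet> b) + (- (?c \<bullet> b)) * 1) * G b (\<phi> q)"
    have ts: "smooth_near p (?t b)" for b by (rule smooth_near_mult[OF cs Gs])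
    have vt: "v (?t b) = v (\<lambda>q. \<phi> q \<bullet> b) * G b ?c" for b
      unfolding tangent_mult[OF v cs Gs] tangent_lincomb[OF v smooth_near_coordinate[OF ch] smooth_near_const[OF p]]
      by (simp add: tangent_const[OF v])
    have "v f = v (\<lambda>q. f p + (\<Sum>b\<in>Basis. ?t b q))"
    proof (rule tangent_local[OF v f chart_preimage_open[OF ch(1) open_ball, of ?c r]])
      show "p \<in> {q \<in> U. \<phi> q \<in> ball ?c r}" using ch r by simp
      show "f q = f p + (\<Sum>b\<in>Basis. ?t b q)" if "q \<in> {q \<in> U. \<phi> q \<in> ball ?c r}" for q
        using hG[of "\<phi> q"] that ch by (simp add: inner_diff_left)
    qed
    also have "\<dots> = v (\<lambda>q. f p) + v (\<lambda>q. \<Sum>b\<in>Basis. ?t b q)"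
      by (rule tangent_add[OF v smooth_near_const[OF p] smooth_near_sum[OF p ts]])
    also have "\<dots> = (\<Sum>b\<in>Basis. v (\<lambda>q. \<phi> q \<bullet> b) * G b ?c)"
      by (simp only: tangent_const[OF v] tangent_sum[OF v p ts] vt add_0)
    also have "\<dots> = chart_derivation U \<phi> p (\<Sum>b\<in>Basis. v (\<lambda>q. \<phi> q \<bullet> b) *\<^sub>R b) f"
      using f has_derivative_linear[OF smooth_near_chart_derivative[OF f ch]]
      by (simp add: chart_derivation_def G(2) linear_sum linear_cmul)
    finally show ?thesis .
  qed
qed

lemma vector_field_tangent: "Y \<in> vector_fields \<Longrightarrow> Y p \<in> tangent_space p"
  unfolding vector_fields_def by blast

lemma vector_field_smooth:
  "Y \<in> vector_fields \<Longrightarrow> openin T W \<Longrightarrow> smooth_fun_on W f \<Longrightarrow> smooth_fun_on W (\<lambda>p. Y p f)"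
  unfolding vector_fields_def by blast

lemma vector_field_smooth_near:
  assumes "Y \<in> vector_fields" "smooth_near p f" shows "smooth_near p (\<lambda>q. Y q f)"
proof -
  obtain W where W: "openin T W" "p \<in> W" "smooth_fun_on W f"
    using assms(2) unfolding smooth_near_def by blast
  show ?thesis by (rule smooth_nearI[OF vector_field_smooth[OF assms(1) W(1,3)] W(1,2)])
qed

lemma vector_fieldI:
  assumes "\<And>p. Y p \<in> tangent_space p" "\<And>p f. smooth_near p f \<Longrightarrow> smooth_near p (\<lambda>q. Y q f)"
  shows "Y \<in> vector_fields"
  unfolding vector_fields_def mem_Collect_eq
proof (intro conjI allI impI; (elim conjE)?)
  show "Y p \<in> tangent_space p" for p by (rule assms(1))
  show "smooth_fun_on W (\<lambda>p. Y p f)" if "openin T W" "smooth_fun_on W f" for W f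
    using smooth_nearI[OF that(2,1)] by (intro smooth_fun_onI_near assms(2))
qed

lemma vector_field_outside:
  assumes "Y \<in> vector_fields" "p \<notin> topspace T" shows "Y p = (\<lambda>f. 0)"
proof
  show "Y p f = 0" for f
    using tangent_not_smooth[OF vector_field_tangent[OF assms(1)]] smooth_near_imp_topspace assms(2) by metis
qed

lemma vector_field_sum:
  assumes "\<And>i. i \<in> I \<Longrightarrow> Y i \<in> vector_fields"
    and "\<And>i. i \<in> I \<Longrightarrow> smooth_fun_on (topspace T) (c i)"
  shows "(\<lambda>p f. \<Sum>i\<in>I. c i p * Y i p f) \<in> vector_fields"
proof (rule vector_fieldI)
  show "(\<lambda>f. \<Sum>i\<in>I. c i p * Y i p f) \<in> tangent_space p" for p
    using assms(1) by (intro tangent_space_sum vector_field_tangent)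
  show "smooth_near p (\<lambda>q. \<Sum>i\<in>I. c i q * Y i q f)" if f: "smooth_near p f" for p f
    using smooth_near_imp_topspace[OF f]
    by (intro smooth_near_sum smooth_near_mult vector_field_smooth_near[OF assms(1) f]
        smooth_fun_on_topspace_near[OF assms(2)])
qed

lemma vf_diff_vector_field:
  assumes "Y \<in> vector_fields" "Z \<in> vector_fields" shows "vf_diff Y Z \<in> vector_fields"
  using vector_field_sum[of "{True, False}" "\<lambda>i. if i then Y else Z" "\<lambda>i p. if i then 1 else -1"] assms
  by (simp add: vf_diff_def smooth_fun_on_const)

text \<open>
  Neither \<open>Y (Z f)\<close> nor \<open>Z (Y f)\<close> obeys the Leibniz rule in \<open>f\<close>, but both deviate from it by the same mixed
  terms \<open>Y f * Z h + Z f * Y h\<close>.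
\<close>
lemma lie_bracket_vector_field:
  assumes Y: "Y \<in> vector_fields" and Z: "Z \<in> vector_fields"
  shows "lie_bracket Y Z \<in> vector_fields"
proof (rule vector_fieldI)
  fix p
  note Ys = vector_field_smooth_near[OF Y] and Zs = vector_field_smooth_near[OF Z]
  have near: "\<exists>W. openin T W \<and> p \<in> W \<and> (\<forall>q\<in>W. smooth_near q f \<and> smooth_near q h)"
    if "smooth_near p f" "smooth_near p h" for f h
  proof -
    obtain W where "openin T W" "p \<in> W" "smooth_fun_on W f" "smooth_fun_on W h"
      using smooth_near_common[OF \<open>smooth_near p f\<close> \<open>smooth_near p h\<close>] by blast
    then show ?thesis using smooth_nearI by (intro exI[of _ W]) simp
  qed
  have lin: "X' p (\<lambda>q. X q (\<lambda>x. a * f x + b * h x)) = a * X' p (\<lambda>q. X q f) + b * X' p (\<lambda>q. X q h)"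
    if "X \<in> vector_fields" "X' \<in> vector_fields" "smooth_near p f" "smooth_near p h" for X X' f h a b
  proof -
    note fh = that(3,4)
    obtain W where W: "openin T W" "p \<in> W" "\<forall>q\<in>W. smooth_near q f \<and> smooth_near q h"
      using near[OF fh] by blast
    note s = vector_field_smooth_near[OF that(1) that(3)] vector_field_smooth_near[OF that(1) that(4)]
    have "X' p (\<lambda>q. a * X q f + b * X q h) = X' p (\<lambda>q. X q (\<lambda>x. a * f x + b * h x))"
      by (rule tangent_local[OF vector_field_tangent[OF that(2)] smooth_near_lincomb[OF s] W(1,2)])
        (use W(3) in \<open>simp only: tangent_lincomb[OF vector_field_tangent[OF that(1)]]\<close>)
    with tangent_lincomb[OF vector_field_tangent[OF that(2)] s, of a b] show ?thesis by argo
  qed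
  have mul: "X' p (\<lambda>q. X q (\<lambda>x. f x * h x)) = X' p (\<lambda>q. X q f) * h p + X p f * X' p h
      + (X' p f * X p h + f p * X' p (\<lambda>q. X q h))"
    if "X \<in> vector_fields" "X' \<in> vector_fields" "smooth_near p f" "smooth_near p h" for X X' f h
  proof -
    note fh = that(3,4)
    obtain W where W: "openin T W" "p \<in> W" "\<forall>q\<in>W. smooth_near q f \<and> smooth_near q h"
      using near[OF fh] by blast
    note s = vector_field_smooth_near[OF that(1) that(3)] vector_field_smooth_near[OF that(1) that(4)]
    note m = smooth_near_mult[OF s(1) that(4)] smooth_near_mult[OF that(3) s(2)]
    note t' = vector_field_tangent[OF that(2)]
    have "X' p (\<lambda>q. X q f * h q + f q * X q h) = X' p (\<lambda>q. X q (\<lambda>x. f x * h x))"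
      by (rule tangent_local[OF t' smooth_near_add[OF m] W(1,2)])
        (use W(3) in \<open>simp only: tangent_mult[OF vector_field_tangent[OF that(1)]]\<close>)
    with tangent_add[OF t' m] tangent_mult[OF t' s(1) that(4)] tangent_mult[OF t' that(3) s(2)]
    show ?thesis by argo
  qed
  show "lie_bracket Y Z p \<in> tangent_space p"
    unfolding tangent_space_def mem_Collect_eq
  proof (intro conjI allI impI; (elim conjE)?)
    show "lie_bracket Y Z p f = 0" if "\<not> smooth_near p f" for f
      using that by (simp add: lie_bracket_def)
    show "lie_bracket Y Z p (\<lambda>x. a * f x + b * h x) = a * lie_bracket Y Z p f + b * lie_bracket Y Z p h"
      if "smooth_near p f" "smooth_near p h" for f h a b
      unfolding lie_bracket_def if_P[OF that(1)] if_P[OF that(2)] if_P[OF smooth_near_lincomb[OF that, of a b]]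
        lin[OF Y Z that] lin[OF Z Y that]
      by (simp add: algebra_simps)
    show "lie_bracket Y Z p (\<lambda>x. f x * h x) = lie_bracket Y Z p f * h p + f p * lie_bracket Y Z p h"
      if "smooth_near p f" "smooth_near p h" for f h
      unfolding lie_bracket_def if_P[OF that(1)] if_P[OF that(2)] if_P[OF smooth_near_mult[OF that]]
        mul[OF Y Z that] mul[OF Z Y that]
      by (simp add: algebra_simps)
  qed
  fix f assume f: "smooth_near p f"
  then obtain W where W: "openin T W" "p \<in> W" "smooth_fun_on W f" unfolding smooth_near_def by blast
  have "smooth_near p (\<lambda>q. 1 * Y q (\<lambda>q. Z q f) + (-1) * Z q (\<lambda>q. Y q f))"
    by (rule smooth_near_lincomb[OF Ys[OF Zs[OF f]] Zs[OF Ys[OF f]]])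
  then show "smooth_near p (\<lambda>q. lie_bracket Y Z q f)"
    by (rule smooth_near_cong[OF _ W(1,2)]) (use W smooth_nearI[OF W(3,1)] in \<open>simp add: lie_bracket_def\<close>)
qed

end

section \<open>Lie groups\<close>

text \<open>
  Gram--Schmidt for an inner product other than the standard one. An orthonormal family that is not
  yet spanning extends by the normalised remainder \<open>r\<close> of any vector outside its span. At length
  \<open>DIM('e)\<close> all remainders vanish, as otherwise \<open>DIM('e) + 1\<close> vectors would be independent.
\<close>
lemma orthonormal_basis_of_inner_product:
  fixes B :: "'e::euclidean_space \<Rightarrow> 'e \<Rightarrow> real"
  assumes lin: "\<And>z. linear (\<lambda>x. B x z)" and sym: "\<And>x y. B x y = B y x"
    and pos: "\<And>x. x \<noteq> 0 \<Longrightarrow> 0 < B x x"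
  obtains e :: "nat \<Rightarrow> 'e" where
    "\<And>i j. i < DIM('e) \<Longrightarrow> j < DIM('e) \<Longrightarrow> B (e i) (e j) = (if i = j then 1 else 0)"
    and "\<And>x. x = (\<Sum>i<DIM('e). B x (e i) *\<^sub>R e i)"
proof -
  define orth where "orth k e \<longleftrightarrow> (\<forall>i<k. \<forall>j<k. B (e i) (e j) = (if i = j then 1 else 0))"
    for k and e :: "nat \<Rightarrow> 'e"
  define r where "r k e x = x - (\<Sum>i<k. B x (e i) *\<^sub>R e i)" for k and e :: "nat \<Rightarrow> 'e" and x
  note diff = linear_diff[OF lin] and sum = linear_sum[OF lin] and scale = linear_cmul[OF lin]
  have comb: "B (\<Sum>i<k. c i *\<^sub>R e i) (e j) = c j" if "orth k e" "j < k" for k e c j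
  proof -
    have "B (\<Sum>i<k. c i *\<^sub>R e i) (e j) = (\<Sum>i<k. if i = j then c i else 0)"
      unfolding sum scale by (rule sum.cong) (use that in \<open>auto simp: orth_def\<close>)
    then show ?thesis using that by simp
  qed
  have r_orth: "B (r k e x) (e j) = 0" if "orth k e" "j < k" for k e x j
    unfolding r_def diff comb[OF that] by simp
  have extend: "\<exists>e'. orth (Suc k) e'" if k: "orth k e" "r k e x \<noteq> 0" for k e x
  proof -
    let ?y = "r k e x"
    define s where "s = sqrt (B ?y ?y)"
    have s: "s > 0" "s * s = B ?y ?y" using pos[OF k(2)] by (simp_all add: s_def)
    have B2: "B u ((1 / s) *\<^sub>R ?y) = B u ?y / s" for u
      using scale[of "1 / s" ?y u] by (simp add: sym[of u])
    have yy: "B ((1 / s) *\<^sub>R ?y) ((1 / s) *\<^sub>R ?y) = 1"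
      unfolding B2 scale using s by (simp add: s(2)[symmetric])
    have ye: "B ((1 / s) *\<^sub>R ?y) (e j) = 0" if "j < k" for j
      unfolding scale using r_orth[OF k(1) that] by simp
    have "orth (Suc k) (e(k := (1 / s) *\<^sub>R ?y))"
      unfolding orth_def
    proof (intro allI impI)
      fix i j assume ij: "i < Suc k" "j < Suc k"
      consider "i = k" "j = k" | "i = k" "j < k" | "i < k" "j = k" | "i < k" "j < k"
        using ij by linarith
      then show "B ((e(k := (1 / s) *\<^sub>R ?y)) i) ((e(k := (1 / s) *\<^sub>R ?y)) j) = (if i = j then 1 else 0)"
      proof cases
        case 3
        then show ?thesis using ye[of i] sym[of "e i"] by simp
      next
        case 4
        then show ?thesis using k(1) by (simp add: orth_def)
      qed (use yy ye in auto)
    qed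
    then show ?thesis by blast
  qed
  have bound: "k \<le> DIM('e)" if k: "orth k e" for k e
  proof -
    have inj: "inj_on e {..<k}"
    proof (rule inj_onI)
      fix i j assume "i \<in> {..<k}" "j \<in> {..<k}" "e i = e j"
      then show "i = j" using k unfolding orth_def by (metis lessThan_iff zero_neq_one)
    qed
    have "independent (e ` {..<k})"
    proof (rule independent_if_scalars_zero)
      fix f x assume f: "(\<Sum>x\<in>e ` {..<k}. f x *\<^sub>R x) = 0" and "x \<in> e ` {..<k}"
      then obtain j where j: "j < k" "x = e j" by blast
      have "(\<Sum>i<k. f (e i) *\<^sub>R e i) = 0" using f by (simp add: sum.reindex[OF inj])
      then show "f x = 0" using comb[OF k j(1), of "\<lambda>i. f (e i)"] linear_0[OF lin] j by simp
    qed simp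
    then have "card (e ` {..<k}) \<le> DIM('e)" using independent_bound by blast
    then show ?thesis by (simp add: card_image[OF inj])
  qed
  have "\<exists>e. orth k e" if "k \<le> DIM('e)" for k
    using that
  proof (induction k)
    case 0
    show ?case by (simp add: orth_def)
  next
    case (Suc k)
    then obtain e where e: "orth k e" by auto
    have "span (e ` {..<k}) \<noteq> UNIV"
    proof
      assume "span (e ` {..<k}) = UNIV"
      then have "DIM('e) \<le> card (e ` {..<k})"
        using dim_le_card[of UNIV "e ` {..<k}"] by simp
      also have "\<dots> \<le> k" using card_image_le[of "{..<k}" e] by simp
      finally show False using Suc.prems by simp
    qed
    then obtain x where x: "x \<notin> span (e ` {..<k})" by blast
    have "r k e x \<noteq> 0"
    proof
      assume "r k e x = 0"
      then have "x = (\<Sum>i<k. B x (e i) *\<^sub>R e i)" by (simp add: r_def)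
      also have "\<dots> \<in> span (e ` {..<k})" by (intro span_sum span_scale span_base) simp
      finally show False using x by blast
    qed
    then show ?case using extend[OF e] by blast
  qed
  then obtain e where e: "orth DIM('e) e" by blast
  show thesis
  proof (rule that[of e])
    show "B (e i) (e j) = (if i = j then 1 else 0)" if "i < DIM('e)" "j < DIM('e)" for i j
      using e that unfolding orth_def by blast
    show "x = (\<Sum>i<DIM('e). B x (e i) *\<^sub>R e i)" for x
    proof (rule ccontr)
      assume "x \<noteq> (\<Sum>i<DIM('e). B x (e i) *\<^sub>R e i)"
      then have "r DIM('e) e x \<noteq> 0" by (simp add: r_def)
      from extend[OF e this] obtain e' where "orth (Suc DIM('e)) e'" by blast
      from bound[OF this] show False by simp
    qed
  qed
qed

context lie_group
begin

lemma one_top: "\<one> \<in> topspace T" by (simp add: topspace_carrier)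

lemma smooth_near_carrier: "smooth_near p f \<Longrightarrow> p \<in> carrier G"
  using smooth_near_imp_topspace topspace_carrier by simp

text \<open>
  The workhorse for smoothness on the group: \<open>f\<close> applied to a product, read in charts of the two factors.
  Left translations are its slices in the second variable, and left-invariant fields are its
  partial derivatives in the second variable at the unit.
\<close>
lemma mult_in_charts:
  assumes ch: "(U, \<phi>) \<in> A" "(V, \<psi>) \<in> A" and W: "openin T W" and f: "smooth_fun_on W f"
  defines "Q \<equiv> {z \<in> \<phi> ` U \<times> \<psi> ` V. inv_into U \<phi> (fst z) \<otimes> inv_into V \<psi> (snd z) \<in> W}"
  shows "open Q" "smooth_on Q (\<lambda>z. f (inv_into U \<phi> (fst z) \<otimes> inv_into V \<psi> (snd z)))"
proof -
  let ?Q = "\<lambda>W. {z \<in> \<phi> ` U \<times> \<psi> ` V. inv_into U \<phi> (fst z) \<otimes> inv_into V \<psi> (snd z) \<in> W}"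
  have cm: "continuous_map (prod_topology T T) T (\<lambda>(x, y). x \<otimes> y)"
    using smooth_mult unfolding smooth_map_def by (rule conjunct1)
  have op: "open (?Q W)" if W: "openin T W" for W
    unfolding open_prod_def
  proof
    fix z assume z: "z \<in> ?Q W"
    then obtain p q where pq: "p \<in> U" "q \<in> V" "z = (\<phi> p, \<psi> q)" by blast
    have pqW: "p \<otimes> q \<in> W" using z pq ch by simp
    let ?P = "{z \<in> topspace (prod_topology T T). (\<lambda>(x, y). x \<otimes> y) z \<in> W}"
    have P: "openin (prod_topology T T) ?P" by (rule openin_continuous_map_preimage[OF cm W])
    have "(p, q) \<in> ?P" using pq pqW chart_subset[OF ch(1)] chart_subset[OF ch(2)] by auto
    then obtain U1 V1 where 1: "openin T U1" "openin T V1" "p \<in> U1" "q \<in> V1" "U1 \<times> V1 \<subseteq> ?P"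
      using P[unfolded openin_prod_topology_alt, rule_format, of p q] by blast
    show "\<exists>X Y. open X \<and> open Y \<and> z \<in> X \<times> Y \<and> X \<times> Y \<subseteq> ?Q W"
    proof (intro exI conjI)
      show "open (\<phi> ` (U \<inter> U1))" "open (\<psi> ` (V \<inter> V1))"
        using chart_image_open[OF ch(1) 1(1)] chart_image_open[OF ch(2) 1(2)] by auto
      show "z \<in> \<phi> ` (U \<inter> U1) \<times> \<psi> ` (V \<inter> V1)" using pq 1 by simp
      show "\<phi> ` (U \<inter> U1) \<times> \<psi> ` (V \<inter> V1) \<subseteq> ?Q W"
      proof
        fix z' assume "z' \<in> \<phi> ` (U \<inter> U1) \<times> \<psi> ` (V \<inter> V1)"
        then obtain p' q' where "p' \<in> U" "p' \<in> U1" "q' \<in> V" "q' \<in> V1" "z' = (\<phi> p', \<psi> q')" by blast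
        moreover from this have "(p', q') \<in> ?P" using 1(5) by blast
        then have "p' \<otimes> q' \<in> W" by simp
        ultimately show "z' \<in> ?Q W" using ch by simp
      qed
    qed
  qed
  show "open Q" unfolding Q_def by (rule op[OF W])
  show "smooth_on Q (\<lambda>z. f (inv_into U \<phi> (fst z) \<otimes> inv_into V \<psi> (snd z)))"
  proof (rule smooth_on_local)
    fix z assume z: "z \<in> Q"
    have "inv_into U \<phi> (fst z) \<otimes> inv_into V \<psi> (snd z) \<in> topspace T"
      using z openin_subset[OF W] unfolding Q_def by blast
    then obtain Z \<theta> where Z: "(Z, \<theta>) \<in> A" "inv_into U \<phi> (fst z) \<otimes> inv_into V \<psi> (snd z) \<in> Z"
      by (rule chart_at)
    let ?N = "?Q (W \<inter> Z)"
    let ?m = "\<lambda>z. inv_into U \<phi> (fst z) \<otimes> inv_into V \<psi> (snd z)"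
    have N: "open ?N" using op[of "W \<inter> Z"] W charts[OF Z(1)] by blast
    have inj: "inj_on (map_prod \<phi> \<psi>) (U \<times> V)"
      using chart_inj[OF ch(1)] chart_inj[OF ch(2)] by (rule map_prod_inj_on)
    have eq: "(\<theta> \<circ> (\<lambda>(x, y). x \<otimes> y) \<circ> inv_into (U \<times> V) (map_prod \<phi> \<psi>)) z = \<theta> (?m z)"
      if z: "z \<in> ?N" for z
    proof -
      obtain p q where pq: "p \<in> U" "q \<in> V" "z = (\<phi> p, \<psi> q)" using z by blast
      then have "inv_into (U \<times> V) (map_prod \<phi> \<psi>) z = (p, q)"
        using inv_into_f_f[OF inj, of "(p, q)"] by simp
      then show ?thesis using pq ch by simp
    qed
    have sub: "?N \<subseteq> map_prod \<phi> \<psi> ` ((U \<times> V) \<inter> (\<lambda>(x, y). x \<otimes> y) -` Z)"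
    proof
      fix z assume z: "z \<in> ?N"
      then obtain p q where pq: "p \<in> U" "q \<in> V" "z = (\<phi> p, \<psi> q)" by blast
      then have "p \<otimes> q \<in> Z" using z ch by simp
      then show "z \<in> map_prod \<phi> \<psi> ` ((U \<times> V) \<inter> (\<lambda>(x, y). x \<otimes> y) -` Z)"
        using pq by (intro image_eqI[of _ _ "(p, q)"]) simp_all
    qed
    have pa: "(U \<times> V, map_prod \<phi> \<psi>) \<in> prod_atlas A A" unfolding prod_atlas_def using ch by blast
    have "smooth_on (map_prod \<phi> \<psi> ` ((U \<times> V) \<inter> (\<lambda>(x, y). x \<otimes> y) -` Z))
        (\<theta> \<circ> (\<lambda>(x, y). x \<otimes> y) \<circ> inv_into (U \<times> V) (map_prod \<phi> \<psi>))"
      using bspec[OF bspec[OF conjunct2[OF smooth_mult[unfolded smooth_map_def]] pa, simplified] Z(1)] by simp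
    from smooth_on_cong_open[OF N eq smooth_on_subset[OF this sub]]
    have m: "smooth_on ?N (\<lambda>z. \<theta> (?m z))" .
    have "smooth_on ?N (\<lambda>z. (\<lambda>x. f (inv_into Z \<theta> x)) (\<theta> (?m z)))"
      by (rule smooth_on_compose[OF N _ m smooth_fun_onD[OF f Z(1)]]) auto
    then have "smooth_on ?N (\<lambda>z. f (?m z))"
      by (rule smooth_on_cong_open[OF N, rotated]) (use Z(1) in simp)
    then show "\<exists>N. open N \<and> z \<in> N \<and> smooth_on N (\<lambda>z. f (?m z))"
      using N z Z(2) unfolding Q_def by blast
  qed
qed

lemma smooth_near_left_translate:
  assumes f: "smooth_near (a \<otimes> p) f" and a: "a \<in> carrier G" and p: "p \<in> carrier G"
  shows "smooth_near p (\<lambda>q. f (a \<otimes> q))"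
proof -
  obtain W where W: "openin T W" "a \<otimes> p \<in> W" "smooth_fun_on W f"
    using f unfolding smooth_near_def by blast
  obtain U \<phi> where U: "(U, \<phi>) \<in> A" "a \<in> U" using a topspace_carrier by (metis chart_at)
  obtain V \<psi> where V: "(V, \<psi>) \<in> A" "p \<in> V" using p topspace_carrier by (metis chart_at)
  define Q where "Q = {z \<in> \<phi> ` U \<times> \<psi> ` V. inv_into U \<phi> (fst z) \<otimes> inv_into V \<psi> (snd z) \<in> W}"
  note Q = mult_in_charts[OF U(1) V(1) W(1,3), folded Q_def]
  let ?S = "Pair (\<phi> a) -` Q"
  have S: "open ?S" by (rule open_vimage[OF Q(1)]) (intro continuous_intros)
  have "smooth_on ?S (\<lambda>y. (\<phi> a, y))"
    by (intro smooth_on_Pair smooth_on_const smooth_on_ident S)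
  from smooth_on_compose[OF S _ this Q(2)]
  have h: "smooth_on ?S (\<lambda>y. f (a \<otimes> inv_into V \<psi> y))" using U by auto
  have "\<psi> p \<in> ?S" using U V W(2) by (simp add: Q_def)
  from smooth_on_chart_near[OF V S this h] show ?thesis
    by (rule smooth_near_cong[where W = V]) (use V charts[OF V(1)] in auto)
qed

text \<open>
  The value at \<open>p\<close> is the push-forward of \<open>v\<close> under left translation by \<open>p\<close>. Written out, it is
  automatically zero for \<open>p\<close> outside the group, as vector fields must be.
\<close>
definition left_field :: "'a tangent_vector \<Rightarrow> 'a vector_field" where
  "left_field v = (\<lambda>p f. if smooth_near p f then v (\<lambda>x. f (p \<otimes> x)) else 0)"

lemma smooth_near_one_translate:
  "smooth_near p f \<Longrightarrow> smooth_near \<one> (\<lambda>x. f (p \<otimes> x))"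
  using smooth_near_left_translate[of p \<one> f] smooth_near_carrier[of p f] by simp

lemma left_translate_tangent:
  assumes v: "v \<in> tangent_space p" and a: "a \<in> carrier G" and p: "p \<in> carrier G"
  shows "push_forward (\<lambda>x. a \<otimes> x) p v \<in> tangent_space (a \<otimes> p)"
  unfolding tangent_space_def mem_Collect_eq
proof (intro conjI allI impI; (elim conjE)?)
  note tr = smooth_near_left_translate[OF _ a p]
  show "push_forward (\<lambda>x. a \<otimes> x) p v f = 0" if "\<not> smooth_near (a \<otimes> p) f" for f
    using that by (simp add: push_forward_def)
  show "push_forward (\<lambda>x. a \<otimes> x) p v (\<lambda>x. c * f x + b * h x) =
      c * push_forward (\<lambda>x. a \<otimes> x) p v f + b * push_forward (\<lambda>x. a \<otimes> x) p v h"
    if "smooth_near (a \<otimes> p) f" "smooth_near (a \<otimes> p) h" for f h c b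
    unfolding push_forward_def comp_def if_P[OF that(1)] if_P[OF that(2)] if_P[OF smooth_near_lincomb[OF that]]
    by (rule tangent_lincomb[OF v tr[OF that(1)] tr[OF that(2)]])
  show "push_forward (\<lambda>x. a \<otimes> x) p v (\<lambda>x. f x * h x) =
      push_forward (\<lambda>x. a \<otimes> x) p v f * h (a \<otimes> p) + f (a \<otimes> p) * push_forward (\<lambda>x. a \<otimes> x) p v h"
    if "smooth_near (a \<otimes> p) f" "smooth_near (a \<otimes> p) h" for f h
    unfolding push_forward_def comp_def if_P[OF that(1)] if_P[OF that(2)] if_P[OF smooth_near_mult[OF that]]
    by (rule tangent_mult[OF v tr[OF that(1)] tr[OF that(2)]])
qed

lemma left_translate_compose:
  assumes v: "v \<in> tangent_space p" and a: "a \<in> carrier G" and b: "b \<in> carrier G" and p: "p \<in> carrier G"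
  shows "push_forward (\<lambda>x. a \<otimes> x) (b \<otimes> p) (push_forward (\<lambda>x. b \<otimes> x) p v) =
    push_forward (\<lambda>x. (a \<otimes> b) \<otimes> x) p v"
proof
  fix f
  have ab: "a \<otimes> (b \<otimes> p) = a \<otimes> b \<otimes> p" using a b p by (simp add: m_assoc)
  show "push_forward (\<lambda>x. a \<otimes> x) (b \<otimes> p) (push_forward (\<lambda>x. b \<otimes> x) p v) f =
      push_forward (\<lambda>x. (a \<otimes> b) \<otimes> x) p v f"
  proof (cases "smooth_near (a \<otimes> b \<otimes> p) f")
    case True
    then have f: "smooth_near (a \<otimes> (b \<otimes> p)) f" by (simp add: ab)
    have s1: "smooth_near (b \<otimes> p) (\<lambda>x. f (a \<otimes> x))"
      using smooth_near_left_translate[OF f a] b p by simp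
    have s2: "smooth_near p (\<lambda>x. f (a \<otimes> (b \<otimes> x)))"
      by (rule smooth_near_left_translate[OF s1 b p])
    have "v (\<lambda>x. f (a \<otimes> (b \<otimes> x))) = v (\<lambda>x. f (a \<otimes> b \<otimes> x))"
      by (rule tangent_local[OF v s2 openin_topspace]) (use a b p in \<open>auto simp: topspace_carrier m_assoc\<close>)
    then show ?thesis using True f s1 by (simp add: push_forward_def comp_def)
  next
    case False
    then show ?thesis by (simp add: push_forward_def ab)
  qed
qed

lemma push_forward_one:
  assumes v: "v \<in> tangent_space p" and p: "p \<in> carrier G"
  shows "push_forward (\<lambda>x. \<one> \<otimes> x) p v = v"
proof
  fix f
  show "push_forward (\<lambda>x. \<one> \<otimes> x) p v f = v f"
  proof (cases "smooth_near p f")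
    case True
    have "v f = v (\<lambda>x. f (\<one> \<otimes> x))"
      by (rule tangent_local[OF v True openin_topspace]) (use p in \<open>auto simp: topspace_carrier\<close>)
    then show ?thesis using True p by (simp add: push_forward_def comp_def)
  next
    case False
    then show ?thesis using tangent_not_smooth[OF v False] p by (simp add: push_forward_def)
  qed
qed

lemma left_field_eq_push_forward:
  "p \<in> carrier G \<Longrightarrow> left_field v p = push_forward (\<lambda>x. p \<otimes> x) \<one> v"
  by (simp add: left_field_def push_forward_def comp_def fun_eq_iff)

lemma left_field_one: "v \<in> tangent_space \<one> \<Longrightarrow> left_field v \<one> = v"
  using left_field_eq_push_forward[of \<one> v] push_forward_one[of v \<one>] by simp

lemma left_field_outside: "p \<notin> carrier G \<Longrightarrow> left_field v p = (\<lambda>f. 0)"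
  using smooth_near_carrier by (auto simp: left_field_def fun_eq_iff)

text \<open>
  Let \<open>F\<close> be \<open>f\<close> applied to products, in charts at \<open>p0\<close> and \<open>\<one>\<close>. As \<open>v\<close> is the directional derivative along
  some \<open>w\<close>, the field applied to \<open>f\<close> is the derivative of \<open>F\<close> along \<open>(0, w)\<close> at the points with second
  coordinate that of \<open>\<one>\<close>, which is smooth in the first coordinate.
\<close>
lemma left_field_vector_field:
  assumes v: "v \<in> tangent_space \<one>"
  shows "left_field v \<in> vector_fields"
proof (rule vector_fieldI)
  show "left_field v p \<in> tangent_space p" for p
  proof (cases "p \<in> carrier G")
    case True
    then show ?thesis using left_translate_tangent[OF v True] by (simp add: left_field_eq_push_forward)
  next
    case False
    then show ?thesis by (simp add: left_field_outside tangent_space_zero)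
  qed
next
  fix p0 f assume f: "smooth_near p0 f"
  then obtain W where W: "openin T W" "p0 \<in> W" "smooth_fun_on W f"
    unfolding smooth_near_def by blast
  have p0: "p0 \<in> topspace T" by (rule smooth_near_imp_topspace[OF f])
  obtain U \<phi> where U: "(U, \<phi>) \<in> A" "p0 \<in> U" by (rule chart_at[OF p0])
  obtain V \<psi> where V: "(V, \<psi>) \<in> A" "\<one> \<in> V" by (rule chart_at[OF one_top])
  define w where "w = (\<Sum>b\<in>Basis. v (\<lambda>q. \<psi> q \<bullet> b) *\<^sub>R b)"
  have vw: "v = chart_derivation V \<psi> \<one> w" unfolding w_def by (rule tangent_eq_chart_derivation[OF V v])
  define Q where "Q = {z \<in> \<phi> ` U \<times> \<psi> ` V. inv_into U \<phi> (fst z) \<otimes> inv_into V \<psi> (snd z) \<in> W}"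
  define F where "F = (\<lambda>z. f (inv_into U \<phi> (fst z) \<otimes> inv_into V \<psi> (snd z)))"
  have Q: "open Q" "smooth_on Q F"
    unfolding Q_def F_def using mult_in_charts[OF U(1) V(1) W(1,3)] by auto
  let ?S = "(\<lambda>x. (x, \<psi> \<one>)) -` Q"
  let ?h = "\<lambda>x. frechet_derivative F (at (x, \<psi> \<one>)) (0, w)"
  have S: "open ?S" by (rule open_vimage[OF Q(1)]) (intro continuous_intros)
  have inQ: "(\<phi> p, \<psi> \<one>) \<in> Q" if "p \<in> U \<inter> W" for p
    using that U V openin_subset[OF W(1)] topspace_carrier by (auto simp: Q_def)
  have "smooth_on ?S (\<lambda>x. (x, \<psi> \<one>))"
    by (intro smooth_on_Pair smooth_on_const smooth_on_ident S)
  from smooth_on_compose[OF S _ this smooth_on_directional_derivative[OF Q(2)]]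
  have h: "smooth_on ?S ?h" by auto
  have "smooth_near p0 (\<lambda>p. ?h (\<phi> p))"
    by (rule smooth_on_chart_near[OF U S _ h]) (use inQ U W in simp)
  then show "smooth_near p0 (\<lambda>p. left_field v p f)"
  proof (rule smooth_near_cong)
    show "openin T (U \<inter> W)" using charts[OF U(1)] W by blast
    show "p0 \<in> U \<inter> W" using U W by blast
    fix p assume p: "p \<in> U \<inter> W"
    have f: "smooth_near p f" using W p smooth_nearI by blast
    have "((\<lambda>y. F (\<phi> p, y)) has_derivative (\<lambda>u. frechet_derivative F (at (\<phi> p, \<psi> \<one>)) (0, u))) (at (\<psi> \<one>))"
      by (rule has_derivative_compose[where g = F and f = "Pair (\<phi> p)", OF _ smooth_on_has_derivative[OF Q(2) inQ[OF p]]])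
        (auto intro!: derivative_eq_intros)
    moreover have "(\<lambda>y. F (\<phi> p, y)) = (\<lambda>x. f (p \<otimes> x)) \<circ> inv_into V \<psi>"
      using p U by (simp add: F_def fun_eq_iff)
    ultimately have "((\<lambda>x. f (p \<otimes> x)) \<circ> inv_into V \<psi> has_derivative
        (\<lambda>u. frechet_derivative F (at (\<phi> p, \<psi> \<one>)) (0, u))) (at (\<psi> \<one>))" by simp
    from chart_derivation_eq[OF this smooth_near_one_translate[OF f]]
    show "?h (\<phi> p) = left_field v p f" using f by (simp add: left_field_def vw)
  qed
qed

lemma left_field_left_invariant:
  assumes v: "v \<in> tangent_space \<one>"
  shows "left_field v \<in> left_invariant_fields"
  unfolding left_invariant_fields_def
proof (intro CollectI conjI ballI left_field_vector_field[OF v])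
  fix a p assume a: "a \<in> carrier G" and p: "p \<in> carrier G"
  show "push_forward (\<lambda>x. a \<otimes> x) p (left_field v p) = left_field v (a \<otimes> p)"
    using left_translate_compose[OF v a p one_closed] a p by (simp add: left_field_eq_push_forward)
qed

lemma left_invariant_vector_field: "Y \<in> left_invariant_fields \<Longrightarrow> Y \<in> vector_fields"
  unfolding left_invariant_fields_def by blast

lemma left_invariant_push:
  "Y \<in> left_invariant_fields \<Longrightarrow> a \<in> carrier G \<Longrightarrow> p \<in> carrier G \<Longrightarrow>
   push_forward (\<lambda>x. a \<otimes> x) p (Y p) = Y (a \<otimes> p)"
  unfolding left_invariant_fields_def by blast

lemma left_invariant_apply:
  assumes "Y \<in> left_invariant_fields" "a \<in> carrier G" "p \<in> carrier G" "smooth_near (a \<otimes> p) f"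
  shows "Y p (\<lambda>x. f (a \<otimes> x)) = Y (a \<otimes> p) f"
  using fun_cong[OF left_invariant_push[OF assms(1-3)], of f] assms(4)
  by (simp add: push_forward_def comp_def)

lemma left_translation_preimage_open:
  assumes "a \<in> carrier G" "openin T W" shows "openin T {q \<in> carrier G. a \<otimes> q \<in> W}"
proof -
  have cm: "continuous_map (prod_topology T T) T (\<lambda>(x, y). x \<otimes> y)"
    using smooth_mult unfolding smooth_map_def by (rule conjunct1)
  have "continuous_map T (prod_topology T T) (\<lambda>q. (a, q))"
    using assms(1) by (intro continuous_map_pairedI) (auto simp: topspace_carrier)
  from openin_continuous_map_preimage[OF continuous_map_compose[OF this cm] assms(2)]
  show ?thesis by (simp add: topspace_carrier)
qed

text \<open>
  A left-invariant field commutes with composition with a left translation, hence so do iterated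
  derivatives along two such fields.
\<close>
lemma lie_bracket_left_invariant:
  assumes X: "X \<in> left_invariant_fields" and Y: "Y \<in> left_invariant_fields"
  shows "lie_bracket X Y \<in> left_invariant_fields"
  unfolding left_invariant_fields_def
proof (intro CollectI conjI ballI ext)
  show "lie_bracket X Y \<in> vector_fields"
    by (intro lie_bracket_vector_field left_invariant_vector_field X Y)
  fix a p f assume a: "a \<in> carrier G" and p: "p \<in> carrier G"
  show "push_forward (\<lambda>x. a \<otimes> x) p (lie_bracket X Y p) f = lie_bracket X Y (a \<otimes> p) f"
  proof (cases "smooth_near (a \<otimes> p) f")
    case True
    then obtain W where W: "openin T W" "a \<otimes> p \<in> W" "smooth_fun_on W f"
      unfolding smooth_near_def by blast
    have swap: "X' p (\<lambda>q. Y' q (\<lambda>x. f (a \<otimes> x))) = X' (a \<otimes> p) (\<lambda>q. Y' q f)"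
      if X': "X' \<in> left_invariant_fields" and Y': "Y' \<in> left_invariant_fields" for X' Y'
    proof -
      have s: "smooth_near (a \<otimes> p) (\<lambda>r. Y' r f)"
        by (rule vector_field_smooth_near[OF left_invariant_vector_field[OF Y'] True])
      have "X' p (\<lambda>q. Y' (a \<otimes> q) f) = X' p (\<lambda>q. Y' q (\<lambda>x. f (a \<otimes> x)))"
      proof (rule tangent_local[OF vector_field_tangent[OF left_invariant_vector_field[OF X']]
              smooth_near_left_translate[OF s a p] left_translation_preimage_open[OF a W(1)]])
        show "p \<in> {q \<in> carrier G. a \<otimes> q \<in> W}" using p W(2) by simp
        fix q assume "q \<in> {q \<in> carrier G. a \<otimes> q \<in> W}"
        then show "Y' (a \<otimes> q) f = Y' q (\<lambda>x. f (a \<otimes> x))"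
          using left_invariant_apply[OF Y' a, of q f] smooth_nearI[OF W(3,1)] by simp
      qed
      then show ?thesis using left_invariant_apply[OF X' a p s] by simp
    qed
    show ?thesis
      using True smooth_near_left_translate[OF True a p] swap[OF X Y] swap[OF Y X]
      by (simp add: push_forward_def lie_bracket_def comp_def)
  qed (simp add: push_forward_def lie_bracket_def)
qed

end

section \<open>The Levi-Civita connection of a global orthonormal frame\<close>

context smooth_manifold
begin

lemma vf_add_vector_field:
  assumes "Y \<in> vector_fields" "Z \<in> vector_fields" shows "vf_add Y Z \<in> vector_fields"
  using vector_field_sum[of "{True, False}" "\<lambda>i. if i then Y else Z" "\<lambda>i p. 1"] assms
  by (simp add: vf_add_def smooth_fun_on_const)

lemma vf_scale_vector_field:
  assumes "Y \<in> vector_fields" "smooth_fun_on (topspace T) h" shows "vf_scale h Y \<in> vector_fields"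
  using vector_field_sum[of "{()}" "\<lambda>i. Y" "\<lambda>i. h"] assms by (simp add: vf_scale_def)

lemma tangent_cong_topspace:
  assumes "v \<in> tangent_space p" "p \<in> topspace T" "smooth_fun_on (topspace T) f"
    and "\<And>q. q \<in> topspace T \<Longrightarrow> h q = f q"
  shows "v h = v f"
  by (rule tangent_local[OF assms(1) smooth_fun_on_topspace_near[OF assms(3,2)] openin_topspace assms(2), symmetric])
    (rule assms(4)[symmetric])

end

context riemannian_manifold
begin

lemma metric_zero_left: "p \<in> topspace T \<Longrightarrow> w \<in> tangent_space p \<Longrightarrow> g p (\<lambda>f. 0) w = 0"
  using metric_linear[of p w w w 0 0] by simp

lemma metric_sum_left:
  assumes "p \<in> topspace T" "w \<in> tangent_space p" "\<And>i. i \<in> I \<Longrightarrow> u i \<in> tangent_space p"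
  shows "g p (\<lambda>f. \<Sum>i\<in>I. c i * u i f) w = (\<Sum>i\<in>I. c i * g p (u i) w)"
  using assms(3)
proof (induction I rule: infinite_finite_induct)
  case (insert i I)
  have "g p (\<lambda>f. c i * u i f + 1 * (\<Sum>i\<in>I. c i * u i f)) w = c i * g p (u i) w + 1 * g p (\<lambda>f. \<Sum>i\<in>I. c i * u i f) w"
    by (rule metric_linear[OF assms(1) _ tangent_space_sum assms(2)]) (use insert.prems in auto)
  then show ?case using insert by simp
qed (simp_all add: metric_zero_left[OF assms(1,2)])

lemma metric_diff_left:
  assumes "p \<in> topspace T" "u \<in> tangent_space p" "v \<in> tangent_space p" "w \<in> tangent_space p"
  shows "g p (\<lambda>f. u f - v f) w = g p u w - g p v w"
  using metric_linear[OF assms, of 1 "-1"] by simp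

lemma metric_add_left:
  assumes "p \<in> topspace T" "u \<in> tangent_space p" "v \<in> tangent_space p" "w \<in> tangent_space p"
  shows "g p (\<lambda>f. u f + v f) w = g p u w + g p v w"
  using metric_linear[OF assms, of 1 1] by simp

lemma metric_scale_left:
  assumes "p \<in> topspace T" "u \<in> tangent_space p" "w \<in> tangent_space p"
  shows "g p (\<lambda>f. c * u f) w = c * g p u w"
  using metric_linear[OF assms(1,2,2,3), of c 0] by simp

end

locale orthonormal_frame = riemannian_manifold T A g
  for T :: "'a topology" and A :: "('a, 'e::euclidean_space) chart set"
    and g :: "'a \<Rightarrow> 'a tangent_vector \<Rightarrow> 'a tangent_vector \<Rightarrow> real" +
  fixes E :: "nat \<Rightarrow> 'a vector_field" and n :: nat
  assumes frame_field: "i < n \<Longrightarrow> E i \<in> vector_fields"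
    and frame_orthonormal: "p \<in> topspace T \<Longrightarrow> i < n \<Longrightarrow> j < n \<Longrightarrow>
          g p (E i p) (E j p) = (if i = j then 1 else 0)"
    and frame_expansion: "p \<in> topspace T \<Longrightarrow> u \<in> tangent_space p \<Longrightarrow>
          u = (\<lambda>f. \<Sum>i<n. g p u (E i p) * E i p f)"
begin

definition coord :: "nat \<Rightarrow> 'a vector_field \<Rightarrow> 'a \<Rightarrow> real" where
  "coord i Y p = g p (Y p) (E i p)"

definition structure_fun :: "nat \<Rightarrow> nat \<Rightarrow> nat \<Rightarrow> 'a \<Rightarrow> real" where
  "structure_fun i j k p = g p (lie_bracket (E i) (E j) p) (E k p)"

text \<open>
  The Koszul formula for the coordinates of the covariant derivative of \<open>E j\<close> along \<open>E i\<close>; the terms with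
  derivatives of the metric are absent because the frame is orthonormal.
\<close>
definition christoffel :: "nat \<Rightarrow> nat \<Rightarrow> nat \<Rightarrow> 'a \<Rightarrow> real" where
  "christoffel i j k p =
     (1 / 2) * (structure_fun i j k p + (- 1) * structure_fun j k i p + structure_fun k i j p)"

text \<open>
  The derivative of the \<open>k\<close>-th coordinate of \<open>Z\<close>, corrected by Christoffel terms: the only formula for an
  affine connection that takes the values \<open>christoffel\<close> on the frame.
\<close>
definition connection_coord :: "'a vector_field \<Rightarrow> 'a vector_field \<Rightarrow> nat \<Rightarrow> 'a \<Rightarrow> real" where
  "connection_coord Y Z k p =
     Y p (coord k Z) + (\<Sum>i<n. \<Sum>j<n. coord i Y p * coord j Z p * christoffel i j k p)"

definition frame_connection :: "'a vector_field \<Rightarrow> 'a vector_field \<Rightarrow> 'a vector_field" where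
  "frame_connection Y Z = (\<lambda>p f. \<Sum>k<n. connection_coord Y Z k p * E k p f)"

lemma frame_tangent: "i < n \<Longrightarrow> E i p \<in> tangent_space p"
  by (rule vector_field_tangent[OF frame_field])

lemma frame_bracket: "i < n \<Longrightarrow> j < n \<Longrightarrow> lie_bracket (E i) (E j) \<in> vector_fields"
  by (intro lie_bracket_vector_field frame_field)

lemma coord_smooth: "Y \<in> vector_fields \<Longrightarrow> i < n \<Longrightarrow> smooth_fun_on (topspace T) (coord i Y)"
  using metric_smooth[of Y "E i"] frame_field[of i] by (simp add: coord_def[abs_def])

lemma structure_fun_smooth:
  "i < n \<Longrightarrow> j < n \<Longrightarrow> k < n \<Longrightarrow> smooth_fun_on (topspace T) (structure_fun i j k)"
  using metric_smooth[OF frame_bracket frame_field, of i j k] by (simp add: structure_fun_def[abs_def])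

lemma christoffel_smooth:
  assumes "i < n" "j < n" "k < n" shows "smooth_fun_on (topspace T) (christoffel i j k)"
  unfolding christoffel_def[abs_def] using assms
  by (intro smooth_fun_on_mult[OF openin_topspace] smooth_fun_on_add[OF openin_topspace]
      smooth_fun_on_const structure_fun_smooth)

lemma connection_coord_smooth:
  assumes Y: "Y \<in> vector_fields" and Z: "Z \<in> vector_fields" and k: "k < n"
  shows "smooth_fun_on (topspace T) (connection_coord Y Z k)"
  unfolding connection_coord_def[abs_def]
  by (rule smooth_fun_on_add[OF openin_topspace vector_field_smooth[OF Y openin_topspace coord_smooth[OF Z k]]],
      rule smooth_fun_on_sum[OF openin_topspace], rule smooth_fun_on_sum[OF openin_topspace],
      rule smooth_fun_on_mult[OF openin_topspace smooth_fun_on_mult[OF openin_topspace]])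
    (use coord_smooth[OF Y] coord_smooth[OF Z] christoffel_smooth k in auto)

lemma frame_connection_vector_field:
  assumes "Y \<in> vector_fields" "Z \<in> vector_fields"
  shows "frame_connection Y Z \<in> vector_fields"
  unfolding frame_connection_def
  by (rule vector_field_sum) (use frame_field connection_coord_smooth[OF assms] in auto)

lemma coord_sum:
  assumes p: "p \<in> topspace T" and k: "k < n"
  shows "g p (\<lambda>f. \<Sum>i<n. c i * E i p f) (E k p) = c k"
proof -
  have "g p (\<lambda>f. \<Sum>i<n. c i * E i p f) (E k p) = (\<Sum>i<n. c i * g p (E i p) (E k p))"
    by (rule metric_sum_left[OF p frame_tangent[OF k]]) (simp add: frame_tangent)
  also have "\<dots> = (\<Sum>i<n. if i = k then c i else 0)"
    by (rule sum.cong) (use frame_orthonormal[OF p] k in auto)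
  finally show ?thesis using k by simp
qed

lemma coord_frame_connection:
  "p \<in> topspace T \<Longrightarrow> k < n \<Longrightarrow> coord k (frame_connection Y Z) p = connection_coord Y Z k p"
  using coord_sum by (simp add: coord_def frame_connection_def)

lemma vector_field_expansion:
  "Y \<in> vector_fields \<Longrightarrow> p \<in> topspace T \<Longrightarrow> Y p f = (\<Sum>i<n. coord i Y p * E i p f)"
  using fun_cong[OF frame_expansion[OF _ vector_field_tangent]] by (simp add: coord_def)

text \<open>
  Reduces the equations between vector fields that define a torsion-free affine connection to equations
  between their coordinates.
\<close>
lemma vector_field_eqI:
  assumes Y: "Y \<in> vector_fields" and Z: "Z \<in> vector_fields"
    and eq: "\<And>p k. p \<in> topspace T \<Longrightarrow> k < n \<Longrightarrow> coord k Y p = coord k Z p"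
  shows "Y = Z"
proof
  fix p show "Y p = Z p"
  proof (cases "p \<in> topspace T")
    case True
    then show ?thesis
      by (intro ext) (simp add: vector_field_expansion[OF Y True] vector_field_expansion[OF Z True] eq)
  qed (simp add: vector_field_outside[OF Y] vector_field_outside[OF Z])
qed

lemma coord_vf_add:
  assumes "Y \<in> vector_fields" "Z \<in> vector_fields" "p \<in> topspace T" "k < n"
  shows "coord k (vf_add Y Z) p = coord k Y p + coord k Z p"
  unfolding coord_def vf_add_def
  by (rule metric_add_left[OF assms(3) vector_field_tangent[OF assms(1)] vector_field_tangent[OF assms(2)] frame_tangent[OF assms(4)]])

lemma coord_vf_diff:
  assumes "Y \<in> vector_fields" "Z \<in> vector_fields" "p \<in> topspace T" "k < n"
  shows "coord k (vf_diff Y Z) p = coord k Y p - coord k Z p"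
  unfolding coord_def vf_diff_def
  by (rule metric_diff_left[OF assms(3) vector_field_tangent[OF assms(1)] vector_field_tangent[OF assms(2)] frame_tangent[OF assms(4)]])

lemma coord_vf_scale:
  assumes "Y \<in> vector_fields" "p \<in> topspace T" "k < n"
  shows "coord k (vf_scale h Y) p = h p * coord k Y p"
  unfolding coord_def vf_scale_def
  by (rule metric_scale_left[OF assms(2) vector_field_tangent[OF assms(1)] frame_tangent[OF assms(3)]])

lemma connection_coord_add_left:
  assumes "Y \<in> vector_fields" "Y' \<in> vector_fields" "p \<in> topspace T"
  shows "connection_coord (vf_add Y Y') Z k p = connection_coord Y Z k p + connection_coord Y' Z k p"
proof -
  have "(\<Sum>i<n. \<Sum>j<n. coord i (vf_add Y Y') p * coord j Z p * christoffel i j k p) =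
     (\<Sum>i<n. \<Sum>j<n. coord i Y p * coord j Z p * christoffel i j k p + coord i Y' p * coord j Z p * christoffel i j k p)"
    by (intro sum.cong refl) (simp add: coord_vf_add[OF assms] distrib_right)
  then show ?thesis by (simp add: connection_coord_def vf_add_def sum.distrib)
qed

lemma connection_coord_add_right:
  assumes Y: "Y \<in> vector_fields" and Z: "Z \<in> vector_fields" "Z' \<in> vector_fields" and p: "p \<in> topspace T" and k: "k < n"
  shows "connection_coord Y (vf_add Z Z') k p = connection_coord Y Z k p + connection_coord Y Z' k p"
proof -
  note s = coord_smooth[OF Z(1) k] coord_smooth[OF Z(2) k]
  have "Y p (coord k (vf_add Z Z')) = Y p (\<lambda>q. coord k Z q + coord k Z' q)"
    by (rule tangent_cong_topspace[OF vector_field_tangent[OF Y] p smooth_fun_on_add[OF openin_topspace s]])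
      (rule coord_vf_add[OF Z _ k])
  also have "\<dots> = Y p (coord k Z) + Y p (coord k Z')"
    by (rule tangent_add[OF vector_field_tangent[OF Y] s[THEN smooth_fun_on_topspace_near, OF p]])
  finally have 1: "Y p (coord k (vf_add Z Z')) = Y p (coord k Z) + Y p (coord k Z')" .
  have "(\<Sum>i<n. \<Sum>j<n. coord i Y p * coord j (vf_add Z Z') p * christoffel i j k p) =
     (\<Sum>i<n. \<Sum>j<n. coord i Y p * coord j Z p * christoffel i j k p + coord i Y p * coord j Z' p * christoffel i j k p)"
    by (intro sum.cong refl) (simp add: coord_vf_add[OF Z p] algebra_simps)
  then show ?thesis by (simp add: connection_coord_def 1 sum.distrib)
qed

lemma connection_coord_scale_left:
  assumes "Y \<in> vector_fields" "p \<in> topspace T"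
  shows "connection_coord (vf_scale h Y) Z k p = h p * connection_coord Y Z k p"
proof -
  have "(\<Sum>i<n. \<Sum>j<n. coord i (vf_scale h Y) p * coord j Z p * christoffel i j k p) =
     (\<Sum>i<n. \<Sum>j<n. h p * (coord i Y p * coord j Z p * christoffel i j k p))"
    by (intro sum.cong refl) (simp add: coord_vf_scale[OF assms])
  then show ?thesis by (simp add: connection_coord_def vf_scale_def sum_distrib_left distrib_left)
qed

lemma connection_coord_scale_right:
  assumes Y: "Y \<in> vector_fields" and Z: "Z \<in> vector_fields" and p: "p \<in> topspace T" and k: "k < n"
    and h: "smooth_fun_on (topspace T) h"
  shows "connection_coord Y (vf_scale h Z) k p = h p * connection_coord Y Z k p + Y p h * coord k Z p"
proof -
  note s = h coord_smooth[OF Z k]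
  have "Y p (coord k (vf_scale h Z)) = Y p (\<lambda>q. h q * coord k Z q)"
    by (rule tangent_cong_topspace[OF vector_field_tangent[OF Y] p smooth_fun_on_mult[OF openin_topspace s]])
      (rule coord_vf_scale[OF Z _ k])
  also have "\<dots> = Y p h * coord k Z p + h p * Y p (coord k Z)"
    by (rule tangent_mult[OF vector_field_tangent[OF Y] s[THEN smooth_fun_on_topspace_near, OF p]])
  finally have 1: "Y p (coord k (vf_scale h Z)) = Y p h * coord k Z p + h p * Y p (coord k Z)" .
  have "(\<Sum>i<n. \<Sum>j<n. coord i Y p * coord j (vf_scale h Z) p * christoffel i j k p) =
     (\<Sum>i<n. \<Sum>j<n. h p * (coord i Y p * coord j Z p * christoffel i j k p))"
    by (intro sum.cong refl) (simp add: coord_vf_scale[OF Z p])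
  then show ?thesis by (simp add: connection_coord_def 1 sum_distrib_left distrib_left)
qed

lemma affine_frame_connection: "affine_connection frame_connection"
  unfolding affine_connection_def
proof (intro conjI ballI allI impI)
  note V = frame_connection_vector_field
  fix Y Z assume Y: "Y \<in> vector_fields" and Z: "Z \<in> vector_fields"
  show "frame_connection Y Z \<in> vector_fields" by (rule V[OF Y Z])
  show "frame_connection (vf_add Y Y') Z = vf_add (frame_connection Y Z) (frame_connection Y' Z)"
    if Y': "Y' \<in> vector_fields" for Y'
    by (rule vector_field_eqI[OF V[OF vf_add_vector_field[OF Y Y'] Z] vf_add_vector_field[OF V[OF Y Z] V[OF Y' Z]]])
      (simp add: coord_vf_add[OF V[OF Y Z] V[OF Y' Z]] coord_frame_connection connection_coord_add_left[OF Y Y'])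
  show "frame_connection Y (vf_add Z Z') = vf_add (frame_connection Y Z) (frame_connection Y Z')"
    if Z': "Z' \<in> vector_fields" for Z'
    by (rule vector_field_eqI[OF V[OF Y vf_add_vector_field[OF Z Z']] vf_add_vector_field[OF V[OF Y Z] V[OF Y Z']]])
      (simp add: coord_vf_add[OF V[OF Y Z] V[OF Y Z']] coord_frame_connection connection_coord_add_right[OF Y Z Z'])
  fix h assume h: "smooth_fun_on (topspace T) h"
  show "frame_connection (vf_scale h Y) Z = vf_scale h (frame_connection Y Z)"
    by (rule vector_field_eqI[OF V[OF vf_scale_vector_field[OF Y h] Z] vf_scale_vector_field[OF V[OF Y Z] h]])
      (simp add: coord_vf_scale[OF V[OF Y Z]] coord_frame_connection connection_coord_scale_left[OF Y])
  have Yh: "smooth_fun_on (topspace T) (\<lambda>p. Y p h)" by (rule vector_field_smooth[OF Y openin_topspace h])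
  note W = vf_scale_vector_field[OF V[OF Y Z] h] vf_scale_vector_field[OF Z Yh]
  show "frame_connection Y (vf_scale h Z) = vf_add (vf_scale h (frame_connection Y Z)) (vf_scale (\<lambda>p. Y p h) Z)"
    by (rule vector_field_eqI[OF V[OF Y vf_scale_vector_field[OF Z h]] vf_add_vector_field[OF W]])
      (simp add: coord_vf_add[OF W] coord_vf_scale[OF V[OF Y Z]] coord_vf_scale[OF Z] coord_frame_connection
        connection_coord_scale_right[OF Y Z _ _ h])
qed

lemma structure_fun_antisym:
  assumes "i < n" "j < n" "k < n" "p \<in> topspace T"
  shows "structure_fun i j k p = - structure_fun j i k p"
proof -
  have "lie_bracket (E i) (E j) p = (\<lambda>f. (-1) * lie_bracket (E j) (E i) p f)"
    by (rule ext) (simp add: lie_bracket_def)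
  then show ?thesis
    using metric_scale_left[OF assms(4) vector_field_tangent[OF frame_bracket] frame_tangent[OF assms(3)], of j i "-1"] assms
    by (simp add: structure_fun_def)
qed

text \<open>
  The product rule for \<open>Z f = \<Sum>\<^sub>j Z\<^sub>j E\<^sub>j f\<close>. Only the double sum contains second derivatives
  of \<open>f\<close>; antisymmetrised in \<open>Y\<close> and \<open>Z\<close>, it turns into brackets of frame fields.
\<close>
lemma derivative_along:
  assumes Y: "Y \<in> vector_fields" and Z: "Z \<in> vector_fields" and p: "p \<in> topspace T" and f: "smooth_near p f"
  shows "Y p (\<lambda>q. Z q f) = (\<Sum>k<n. Y p (coord k Z) * E k p f)
    + (\<Sum>i<n. \<Sum>j<n. coord i Y p * coord j Z p * E i p (\<lambda>q. E j q f))"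
proof -
  have Ef: "smooth_near p (\<lambda>q. E j q f)" if "j < n" for j
    by (rule vector_field_smooth_near[OF frame_field[OF that] f])
  have cs: "smooth_near p (coord j Z)" if "j < n" for j
    by (rule smooth_fun_on_topspace_near[OF coord_smooth[OF Z that] p])
  note m = smooth_near_mult[OF cs Ef]
  have "Y p (\<lambda>q. \<Sum>j<n. coord j Z q * E j q f) = Y p (\<lambda>q. Z q f)"
    by (rule tangent_local[OF vector_field_tangent[OF Y] smooth_near_sum[OF p] openin_topspace p])
      (use m vector_field_expansion[OF Z] in auto)
  moreover have "Y p (\<lambda>q. \<Sum>j<n. coord j Z q * E j q f) = (\<Sum>j<n. Y p (\<lambda>q. coord j Z q * E j q f))"
    by (rule tangent_sum[OF vector_field_tangent[OF Y] p]) (use m in auto)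
  moreover have "\<dots> = (\<Sum>j<n. Y p (coord j Z) * E j p f + (\<Sum>i<n. coord i Y p * coord j Z p * E i p (\<lambda>q. E j q f)))"
  proof (rule sum.cong[OF refl])
    fix j assume "j \<in> {..<n}"
    then have j: "j < n" by simp
    have "Y p (\<lambda>q. E j q f) = (\<Sum>i<n. coord i Y p * E i p (\<lambda>q. E j q f))"
      by (rule vector_field_expansion[OF Y p])
    then have "coord j Z p * Y p (\<lambda>q. E j q f) = (\<Sum>i<n. coord i Y p * coord j Z p * E i p (\<lambda>q. E j q f))"
      by (simp add: sum_distrib_left mult_ac)
    then show "Y p (\<lambda>q. coord j Z q * E j q f) =
        Y p (coord j Z) * E j p f + (\<Sum>i<n. coord i Y p * coord j Z p * E i p (\<lambda>q. E j q f))"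
      using tangent_mult[OF vector_field_tangent[OF Y] cs[OF j] Ef[OF j]] by simp
  qed
  moreover have "(\<Sum>j<n. \<Sum>i<n. coord i Y p * coord j Z p * E i p (\<lambda>q. E j q f)) =
      (\<Sum>i<n. \<Sum>j<n. coord i Y p * coord j Z p * E i p (\<lambda>q. E j q f))"
    by (rule sum.swap)
  ultimately show ?thesis by (simp add: sum.distrib)
qed

lemma coord_lie_bracket:
  assumes Y: "Y \<in> vector_fields" and Z: "Z \<in> vector_fields" and p: "p \<in> topspace T" and l: "l < n"
  shows "coord l (lie_bracket Y Z) p = Y p (coord l Z) - Z p (coord l Y)
    + (\<Sum>i<n. \<Sum>j<n. coord i Y p * coord j Z p * structure_fun i j l p)"
proof -
  let ?a = "\<lambda>k. Y p (coord k Z) - Z p (coord k Y)"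
  let ?I = "{..<n} \<times> {..<n}"
  let ?b = "\<lambda>ij. coord (fst ij) Y p * coord (snd ij) Z p"
  let ?L = "\<lambda>ij. lie_bracket (E (fst ij)) (E (snd ij)) p"
  have "lie_bracket Y Z p = (\<lambda>f. (\<Sum>k<n. ?a k * E k p f) + (\<Sum>ij\<in>?I. ?b ij * ?L ij f))"
  proof
    fix f
    show "lie_bracket Y Z p f = (\<Sum>k<n. ?a k * E k p f) + (\<Sum>ij\<in>?I. ?b ij * ?L ij f)"
    proof (cases "smooth_near p f")
      case True
      have "(\<Sum>i<n. \<Sum>j<n. coord i Z p * coord j Y p * E i p (\<lambda>q. E j q f)) =
          (\<Sum>i<n. \<Sum>j<n. coord i Y p * coord j Z p * E j p (\<lambda>q. E i q f))"
        by (subst sum.swap) (simp add: mult_ac)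
      then have "lie_bracket Y Z p f = (\<Sum>k<n. Y p (coord k Z) * E k p f) - (\<Sum>k<n. Z p (coord k Y) * E k p f)
          + ((\<Sum>i<n. \<Sum>j<n. coord i Y p * coord j Z p * E i p (\<lambda>q. E j q f))
             - (\<Sum>i<n. \<Sum>j<n. coord i Y p * coord j Z p * E j p (\<lambda>q. E i q f)))"
        using True derivative_along[OF Y Z p True] derivative_along[OF Z Y p True] by (simp add: lie_bracket_def)
      also have "\<dots> = (\<Sum>k<n. ?a k * E k p f) + (\<Sum>i<n. \<Sum>j<n. ?b (i, j) * ?L (i, j) f)"
        using True by (simp add: lie_bracket_def sum_subtractf[symmetric] left_diff_distrib right_diff_distrib)
      also have "(\<Sum>i<n. \<Sum>j<n. ?b (i, j) * ?L (i, j) f) = (\<Sum>ij\<in>?I. ?b ij * ?L ij f)"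
        by (simp add: sum.cartesian_product case_prod_beta)
      finally show ?thesis .
    next
      case False
      have "(\<Sum>k<n. ?a k * E k p f) = 0"
        using tangent_not_smooth[OF frame_tangent False] by (intro sum.neutral) simp
      then show ?thesis using False by (simp add: lie_bracket_def)
    qed
  qed
  then have "coord l (lie_bracket Y Z) p =
      g p (\<lambda>f. (\<Sum>k<n. ?a k * E k p f) + (\<Sum>ij\<in>?I. ?b ij * ?L ij f)) (E l p)"
    by (simp add: coord_def)
  also have "\<dots> = g p (\<lambda>f. \<Sum>k<n. ?a k * E k p f) (E l p) + g p (\<lambda>f. \<Sum>ij\<in>?I. ?b ij * ?L ij f) (E l p)"
  proof (rule metric_add_left[OF p _ _ frame_tangent[OF l]])
    show "(\<lambda>f. \<Sum>k<n. ?a k * E k p f) \<in> tangent_space p"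
      by (rule tangent_space_sum) (simp add: frame_tangent)
    show "(\<lambda>f. \<Sum>ij\<in>?I. ?b ij * ?L ij f) \<in> tangent_space p"
      by (rule tangent_space_sum) (auto intro: vector_field_tangent[OF frame_bracket])
  qed
  also have "g p (\<lambda>f. \<Sum>k<n. ?a k * E k p f) (E l p) = ?a l" by (rule coord_sum[OF p l])
  also have "g p (\<lambda>f. \<Sum>ij\<in>?I. ?b ij * ?L ij f) (E l p) = (\<Sum>ij\<in>?I. ?b ij * g p (?L ij) (E l p))"
    by (rule metric_sum_left[OF p frame_tangent[OF l]]) (auto intro: vector_field_tangent[OF frame_bracket])
  also have "\<dots> = (\<Sum>i<n. \<Sum>j<n. coord i Y p * coord j Z p * structure_fun i j l p)"
    by (simp add: sum.cartesian_product case_prod_beta structure_fun_def)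
  finally show ?thesis .
qed

lemma torsion_free_frame_connection: "torsion_free frame_connection"
  unfolding torsion_free_def
proof (intro ballI)
  note V = frame_connection_vector_field
  fix Y Z assume Y: "Y \<in> vector_fields" and Z: "Z \<in> vector_fields"
  show "vf_diff (frame_connection Y Z) (frame_connection Z Y) = lie_bracket Y Z"
  proof (rule vector_field_eqI[OF vf_diff_vector_field[OF V[OF Y Z] V[OF Z Y]] lie_bracket_vector_field[OF Y Z]])
    fix p k assume p: "p \<in> topspace T" and k: "k < n"
    have "(\<Sum>i<n. \<Sum>j<n. coord i Z p * coord j Y p * christoffel i j k p) =
        (\<Sum>i<n. \<Sum>j<n. coord i Y p * coord j Z p * christoffel j i k p)"
      by (subst sum.swap) (simp add: mult_ac)
    then have "coord k (vf_diff (frame_connection Y Z) (frame_connection Z Y)) p =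
        Y p (coord k Z) - Z p (coord k Y)
        + (\<Sum>i<n. \<Sum>j<n. coord i Y p * coord j Z p * (christoffel i j k p - christoffel j i k p))"
      by (simp add: coord_vf_diff[OF V[OF Y Z] V[OF Z Y] p k] coord_frame_connection[OF p k]
          connection_coord_def sum_subtractf right_diff_distrib)
    also have "(\<Sum>i<n. \<Sum>j<n. coord i Y p * coord j Z p * (christoffel i j k p - christoffel j i k p)) =
        (\<Sum>i<n. \<Sum>j<n. coord i Y p * coord j Z p * structure_fun i j k p)"
    proof (intro sum.cong refl)
      fix i j assume "i \<in> {..<n}" "j \<in> {..<n}"
      then have ij: "i < n" "j < n" by auto
      have "christoffel i j k p - christoffel j i k p = structure_fun i j k p"
        using structure_fun_antisym[OF ij k p] structure_fun_antisym[OF ij(1) k ij(2) p]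
          structure_fun_antisym[OF ij(2) k ij(1) p]
        by (simp add: christoffel_def field_simps)
      then show "coord i Y p * coord j Z p * (christoffel i j k p - christoffel j i k p) =
        coord i Y p * coord j Z p * structure_fun i j k p" by simp
    qed
    finally show "coord k (vf_diff (frame_connection Y Z) (frame_connection Z Y)) p = coord k (lie_bracket Y Z) p"
      using coord_lie_bracket[OF Y Z p k] by simp
  qed
qed

lemma metric_coord:
  assumes Y: "Y \<in> vector_fields" and Z: "Z \<in> vector_fields" and p: "p \<in> topspace T"
  shows "g p (Y p) (Z p) = (\<Sum>k<n. coord k Y p * coord k Z p)"
proof -
  have "g p (Y p) (Z p) = g p (\<lambda>f. \<Sum>i<n. coord i Y p * E i p f) (Z p)"
    using vector_field_expansion[OF Y p] by presburger
  also have "\<dots> = (\<Sum>i<n. coord i Y p * g p (E i p) (Z p))"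
    by (rule metric_sum_left[OF p vector_field_tangent[OF Z]]) (simp add: frame_tangent)
  also have "\<dots> = (\<Sum>k<n. coord k Y p * coord k Z p)"
    by (intro sum.cong refl) (simp add: coord_def metric_sym[OF p frame_tangent vector_field_tangent[OF Z]])
  finally show ?thesis .
qed

text \<open>
  This antisymmetry is what makes the connection compatible with the metric.
\<close>
lemma christoffel_antisym:
  assumes "i < n" "j < n" "k < n" "p \<in> topspace T"
  shows "christoffel i j k p = - christoffel i k j p"
  using structure_fun_antisym[OF assms] structure_fun_antisym[OF assms(1,3,2,4)]
    structure_fun_antisym[OF assms(2,3,1,4)]
  by (simp add: christoffel_def field_simps)

text \<open>
  The derivative of \<open>g(Z, W) = \<Sum>\<^sub>k Z\<^sub>k W\<^sub>k\<close> accounts for the terms with derivatives of coordinates. It remains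
  to see that the Christoffel terms of \<open>Z\<close> and \<open>W\<close> cancel: exchange \<open>j\<close> and \<open>k\<close> in the second sum and
  use the antisymmetry of the Christoffel symbols.
\<close>
lemma metric_compatible_frame_connection: "metric_compatible frame_connection"
  unfolding metric_compatible_def
proof (intro ballI)
  note V = frame_connection_vector_field
  fix Y Z W p
  assume Y: "Y \<in> vector_fields" and Z: "Z \<in> vector_fields" and W: "W \<in> vector_fields" and p: "p \<in> topspace T"
  note Yt = vector_field_tangent[OF Y]
  note cZ = coord_smooth[OF Z] and cW = coord_smooth[OF W]
  have s: "smooth_fun_on (topspace T) (\<lambda>q. coord k Z q * coord k W q)" if "k < n" for k
    by (rule smooth_fun_on_mult[OF openin_topspace cZ[OF that] cW[OF that]])
  have "Y p (\<lambda>q. g q (Z q) (W q)) = Y p (\<lambda>q. \<Sum>k<n. coord k Z q * coord k W q)"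
    by (rule tangent_cong_topspace[OF Yt p smooth_fun_on_sum[OF openin_topspace s] metric_coord[OF Z W]]) simp_all
  also have "\<dots> = (\<Sum>k<n. Y p (\<lambda>q. coord k Z q * coord k W q))"
    by (rule tangent_sum[OF Yt p smooth_fun_on_topspace_near[OF s p]]) simp
  also have "\<dots> = (\<Sum>k<n. Y p (coord k Z) * coord k W p + coord k Z p * Y p (coord k W))"
    by (intro sum.cong refl tangent_mult[OF Yt smooth_fun_on_topspace_near[OF cZ p] smooth_fun_on_topspace_near[OF cW p]])
      simp_all
  finally have lhs: "Y p (\<lambda>q. g q (Z q) (W q)) =
      (\<Sum>k<n. Y p (coord k Z) * coord k W p) + (\<Sum>k<n. coord k Z p * Y p (coord k W))"
    by (simp add: sum.distrib)
  let ?S = "\<lambda>Z W. \<Sum>k<n. \<Sum>i<n. \<Sum>j<n. coord i Y p * coord j Z p * christoffel i j k p * coord k W p"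
  have "g p (frame_connection Y Z p) (W p) = (\<Sum>k<n. connection_coord Y Z k p * coord k W p)"
    using metric_coord[OF V[OF Y Z] W p] coord_frame_connection[OF p] by simp
  then have 1: "g p (frame_connection Y Z p) (W p) = (\<Sum>k<n. Y p (coord k Z) * coord k W p) + ?S Z W"
    by (simp add: connection_coord_def distrib_right sum.distrib sum_distrib_right)
  have "g p (Z p) (frame_connection Y W p) = (\<Sum>k<n. coord k Z p * connection_coord Y W k p)"
    using metric_coord[OF Z V[OF Y W] p] coord_frame_connection[OF p] by simp
  then have 2: "g p (Z p) (frame_connection Y W p) = (\<Sum>k<n. coord k Z p * Y p (coord k W)) + ?S W Z"
    by (simp add: connection_coord_def distrib_left sum.distrib sum_distrib_left mult_ac)
  have "?S W Z = (\<Sum>k<n. \<Sum>j<n. \<Sum>i<n. coord i Y p * coord j W p * christoffel i j k p * coord k Z p)"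
    by (rule sum.cong[OF refl], rule sum.swap)
  also have "\<dots> = (\<Sum>j<n. \<Sum>k<n. \<Sum>i<n. coord i Y p * coord j W p * christoffel i j k p * coord k Z p)"
    by (rule sum.swap)
  also have "\<dots> = (\<Sum>j<n. \<Sum>i<n. \<Sum>k<n. coord i Y p * coord j W p * christoffel i j k p * coord k Z p)"
    by (rule sum.cong[OF refl], rule sum.swap)
  also have "\<dots> = (\<Sum>k<n. \<Sum>i<n. \<Sum>j<n. - (coord i Y p * coord j Z p * christoffel i j k p * coord k W p))"
  proof (intro sum.cong refl)
    fix k i j assume "k \<in> {..<n}" "i \<in> {..<n}" "j \<in> {..<n}"
    then have "christoffel i k j p = - christoffel i j k p"
      by (intro christoffel_antisym[OF _ _ _ p]) simp_all
    then show "coord i Y p * coord k W p * christoffel i k j p * coord j Z p =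
        - (coord i Y p * coord j Z p * christoffel i j k p * coord k W p)" by simp
  qed
  also have "\<dots> = - ?S Z W" by (simp add: sum_negf)
  finally show "Y p (\<lambda>q. g q (Z q) (W q)) = g p (frame_connection Y Z p) (W p) + g p (Z p) (frame_connection Y W p)"
    using lhs 1 2 by simp
qed

text \<open>
  A Levi-Civita connection exists, so the choice operator in its definition picks one.
\<close>
lemma levi_civita_connection:
  "affine_connection levi_civita" "torsion_free levi_civita" "metric_compatible levi_civita"
proof -
  have "affine_connection levi_civita \<and> torsion_free levi_civita \<and> metric_compatible levi_civita"
    unfolding levi_civita_def
    by (rule someI[of _ frame_connection])
      (intro conjI affine_frame_connection torsion_free_frame_connection metric_compatible_frame_connection)
  then show "affine_connection levi_civita" "torsion_free levi_civita" "metric_compatible levi_civita" by auto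
qed

end

section \<open>Curvature of cyclic metrics\<close>

lemma sum_cyclic_shift:
  fixes F :: "nat \<Rightarrow> nat \<Rightarrow> nat \<Rightarrow> real"
  shows "(\<Sum>i<n. \<Sum>j<n. \<Sum>k<n. F k i j) = (\<Sum>i<n. \<Sum>j<n. \<Sum>k<n. F i j k)"
proof -
  have "(\<Sum>i<n. \<Sum>j<n. \<Sum>k<n. F k i j) = (\<Sum>i<n. \<Sum>k<n. \<Sum>j<n. F k i j)"
    by (rule sum.cong[OF refl], rule sum.swap)
  also have "\<dots> = (\<Sum>k<n. \<Sum>i<n. \<Sum>j<n. F k i j)" by (rule sum.swap)
  finally show ?thesis .
qed

text \<open>
  The first term sums to \<open>- (\<Sum>k. (\<Sum>i. c k i i)\<^sup>2)\<close>. The other two are compared through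
  \<open>2 x y \<le> x\<^sup>2 + y\<^sup>2\<close>, since permuting the indices does not change the sum of all squares.
\<close>
lemma scalar_curvature_sum_nonpos:
  fixes c :: "nat \<Rightarrow> nat \<Rightarrow> nat \<Rightarrow> real"
  shows "(\<Sum>i<n. \<Sum>j<n. \<Sum>k<n. - (c k j j * c k i i) + c k j i * c k i j - c i j k * c i j k) \<le> 0"
proof -
  let ?Q = "\<Sum>i<n. \<Sum>j<n. \<Sum>k<n. c i j k * c i j k"
  have "(\<Sum>i<n. \<Sum>j<n. \<Sum>k<n. c k j j * c k i i) = (\<Sum>k<n. \<Sum>i<n. \<Sum>j<n. c k j j * c k i i)"
    by (rule sum_cyclic_shift[where F = "\<lambda>k i j. c k j j * c k i i"])
  also have "\<dots> = (\<Sum>k<n. (\<Sum>i<n. c k i i) * (\<Sum>j<n. c k j j))"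
    by (simp add: sum_product mult.commute)
  also have "\<dots> \<ge> 0" by (intro sum_nonneg) simp
  finally have trace: "(\<Sum>i<n. \<Sum>j<n. \<Sum>k<n. c k j j * c k i i) \<ge> 0" .
  have Q1: "(\<Sum>i<n. \<Sum>j<n. \<Sum>k<n. c k i j * c k i j) = ?Q"
    by (rule sum_cyclic_shift[where F = "\<lambda>k i j. c k i j * c k i j"])
  have "(\<Sum>i<n. \<Sum>j<n. \<Sum>k<n. c k j i * c k j i) = (\<Sum>j<n. \<Sum>i<n. \<Sum>k<n. c k j i * c k j i)"
    by (rule sum.swap)
  also have "\<dots> = ?Q" by (rule Q1)
  finally have Q2: "(\<Sum>i<n. \<Sum>j<n. \<Sum>k<n. c k j i * c k j i) = ?Q" .
  have "2 * (x * y) \<le> x * x + y * y" for x y :: real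
    using zero_le_square[of "x - y"] by (simp add: algebra_simps)
  then have "(\<Sum>i<n. \<Sum>j<n. \<Sum>k<n. 2 * (c k j i * c k i j)) \<le>
      (\<Sum>i<n. \<Sum>j<n. \<Sum>k<n. c k j i * c k j i + c k i j * c k i j)"
    by (intro sum_mono)
  also have "\<dots> = 2 * ?Q" by (simp only: sum.distrib Q1 Q2)
  finally have "(\<Sum>i<n. \<Sum>j<n. \<Sum>k<n. c k j i * c k i j) \<le> ?Q"
    by (simp only: sum_distrib_left[symmetric])
  with trace show ?thesis by (simp add: sum.distrib sum_subtractf sum_negf)
qed

context smooth_manifold
begin

lemma affine_connection_closed:
  "affine_connection D \<Longrightarrow> Y \<in> vector_fields \<Longrightarrow> Z \<in> vector_fields \<Longrightarrow> D Y Z \<in> vector_fields"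
  unfolding affine_connection_def by (elim conjE) simp

lemma affine_connection_add:
  assumes "affine_connection D" "Y \<in> vector_fields" "Y' \<in> vector_fields" "Z \<in> vector_fields"
  shows "D (vf_add Y Y') Z = vf_add (D Y Z) (D Y' Z)"
proof -
  have "\<forall>Y\<in>vector_fields. \<forall>Y'\<in>vector_fields. \<forall>Z\<in>vector_fields. D (vf_add Y Y') Z = vf_add (D Y Z) (D Y' Z)"
    using assms(1) unfolding affine_connection_def by (elim conjE)
  from this[rule_format, OF assms(2-4)] show ?thesis .
qed

lemma affine_connection_scale:
  assumes "affine_connection D" "Y \<in> vector_fields" "Z \<in> vector_fields" "smooth_fun_on (topspace T) h"
  shows "D (vf_scale h Y) Z = vf_scale h (D Y Z)"
proof -
  have "\<forall>Y\<in>vector_fields. \<forall>Z\<in>vector_fields. \<forall>h. smooth_fun_on (topspace T) h \<longrightarrow>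
        D (vf_scale h Y) Z = vf_scale h (D Y Z) \<and>
        D Y (vf_scale h Z) = vf_add (vf_scale h (D Y Z)) (vf_scale (\<lambda>p. Y p h) Z)"
    using assms(1) unfolding affine_connection_def by (elim conjE)
  from this[rule_format, OF assms(2-4)] show ?thesis by (rule conjunct1)
qed

lemma affine_connection_sum:
  fixes m :: nat
  assumes D: "affine_connection D" and Z: "Z \<in> vector_fields" and Y: "\<And>k. k < m \<Longrightarrow> Y k \<in> vector_fields"
  shows "D (\<lambda>p f. \<Sum>k<m. c k * Y k p f) Z = (\<lambda>p f. \<Sum>k<m. c k * D (Y k) Z p f)"
  using Y
proof (induction m)
  case 0
  \<comment> \<open>The empty sum is the zero field, which is the field \<open>Z\<close> scaled by 0.\<close>
  show ?case
    using affine_connection_scale[OF D Z Z smooth_fun_on_const, of 0] by (simp add: vf_scale_def)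
next
  case (Suc m)
  let ?S = "\<lambda>p f. \<Sum>k<m. c k * Y k p f"
  have Ym: "Y m \<in> vector_fields" using Suc.prems by simp
  have S: "?S \<in> vector_fields"
    by (rule vector_field_sum) (use Suc.prems smooth_fun_on_const in auto)
  have "D (vf_add ?S (vf_scale (\<lambda>p. c m) (Y m))) Z = vf_add (D ?S Z) (vf_scale (\<lambda>p. c m) (D (Y m) Z))"
    using affine_connection_add[OF D S vf_scale_vector_field[OF Ym smooth_fun_on_const] Z]
      affine_connection_scale[OF D Ym Z smooth_fun_on_const] by simp
  then show ?case using Suc by (simp add: vf_add_def vf_scale_def)
qed

end

context orthonormal_frame
begin

lemma levi_civita_vector_field:
  "Y \<in> vector_fields \<Longrightarrow> Z \<in> vector_fields \<Longrightarrow> levi_civita Y Z \<in> vector_fields"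
  by (rule affine_connection_closed[OF levi_civita_connection(1)])

lemma levi_civita_frame_field:
  "i < n \<Longrightarrow> j < n \<Longrightarrow> levi_civita (E i) (E j) \<in> vector_fields"
  by (intro levi_civita_vector_field frame_field)

lemma levi_civita_compatible:
  assumes "Y \<in> vector_fields" "Z \<in> vector_fields" "W \<in> vector_fields" "p \<in> topspace T"
  shows "Y p (\<lambda>q. g q (Z q) (W q)) = g p (levi_civita Y Z p) (W p) + g p (Z p) (levi_civita Y W p)"
  using levi_civita_connection(3)[unfolded metric_compatible_def, rule_format, OF assms] .

text \<open>
  The Koszul argument: the inner products of frame fields are constant, so compatibility with the
  metric is antisymmetry in \<open>j\<close> and \<open>k\<close>. Together with the absence of torsion this leaves one solution,
  whichever connection was chosen.
\<close>
lemma coord_levi_civita_frame: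
  assumes i: "i < n" and j: "j < n" and k: "k < n" and p: "p \<in> topspace T"
  shows "coord k (levi_civita (E i) (E j)) p = christoffel i j k p"
proof -
  let ?a = "\<lambda>i j k. coord k (levi_civita (E i) (E j)) p"
  have anti: "?a i j k = - ?a i k j" if ijk: "i < n" "j < n" "k < n" for i j k
  proof -
    have "E i p (\<lambda>q. g q (E j q) (E k q)) = 0"
      by (rule tangent_locally_const[OF frame_tangent[OF ijk(1)] p frame_orthonormal[OF _ ijk(2,3)]])
    then show ?thesis
      using levi_civita_compatible[OF frame_field[OF ijk(1)] frame_field[OF ijk(2)] frame_field[OF ijk(3)] p]
        metric_sym[OF p frame_tangent[OF ijk(2)] vector_field_tangent[OF levi_civita_frame_field[OF ijk(1,3)]]]
      by (simp add: coord_def)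
  qed
  have tors: "?a i j k - ?a j i k = structure_fun i j k p" if ijk: "i < n" "j < n" "k < n" for i j k
  proof -
    have "vf_diff (levi_civita (E i) (E j)) (levi_civita (E j) (E i)) = lie_bracket (E i) (E j)"
      using levi_civita_connection(2)[unfolded torsion_free_def, rule_format, OF frame_field[OF ijk(1)] frame_field[OF ijk(2)]] .
    then show ?thesis
      using coord_vf_diff[OF levi_civita_frame_field[OF ijk(1,2)] levi_civita_frame_field[OF ijk(2,1)] p ijk(3)]
      by (simp add: coord_def structure_fun_def)
  qed
  show ?thesis
    unfolding christoffel_def tors[OF i j k, symmetric] tors[OF j k i, symmetric] tors[OF k i j, symmetric]
    using anti[OF i j k] anti[OF j k i] anti[OF k i j] by simp
qed

text \<open>
  The derivative of a constant inner product vanishes, which moves the covariant derivative from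
  \<open>V\<close> to \<open>E k\<close>. This yields second covariant derivatives of frame fields.
\<close>
lemma levi_civita_const_coords:
  assumes i: "i < n" and k: "k < n" and V: "V \<in> vector_fields" and p: "p \<in> topspace T"
    and const: "\<And>q. q \<in> topspace T \<Longrightarrow> coord k V q = a"
  shows "coord k (levi_civita (E i) V) p = - (\<Sum>l<n. coord l V p * christoffel i k l p)"
proof -
  have "E i p (\<lambda>q. g q (V q) (E k q)) = 0"
    by (rule tangent_locally_const[OF frame_tangent[OF i] p]) (use const in \<open>simp add: coord_def\<close>)
  moreover have "g p (V p) (levi_civita (E i) (E k) p) = (\<Sum>l<n. coord l V p * christoffel i k l p)"
    using metric_coord[OF V levi_civita_frame_field[OF i k] p] coord_levi_civita_frame[OF i k _ p] by simp
  ultimately show ?thesis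
    using levi_civita_compatible[OF frame_field[OF i] V frame_field[OF k] p] by (simp add: coord_def)
qed

text \<open>
  Under \<open>const\<close> and \<open>cyc\<close> the coordinates of \<open>levi_civita (E i) (E j)\<close> are \<open>c k j i\<close>. The three summands come,
  in order, from the two second covariant derivatives and from the derivative along the bracket.
\<close>
lemma frame_curvature:
  assumes const: "\<And>i j k p. i < n \<Longrightarrow> j < n \<Longrightarrow> k < n \<Longrightarrow> p \<in> topspace T \<Longrightarrow> structure_fun i j k p = c i j k"
    and cyc: "\<And>i j k. i < n \<Longrightarrow> j < n \<Longrightarrow> k < n \<Longrightarrow> c i j k + c j k i + c k i j = 0"
    and i: "i < n" and j: "j < n" and p: "p \<in> topspace T"
  shows "g p (curvature levi_civita (E i) (E j) (E j) p) (E i p) =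
    (\<Sum>k<n. - (c k j j * c k i i) + c k j i * c k i j - c i j k * c i j k)"
proof -
  let ?D = levi_civita
  have \<Gamma>: "christoffel i j k p = c k j i" if "i < n" "j < n" "k < n" "p \<in> topspace T" for i j k p
    using structure_fun_antisym[OF that(2,3,1,4)] cyc[OF that(1,2,3)] that
    by (simp add: christoffel_def const)
  have coords: "coord k (?D (E i) (E j)) p = c k j i" if "i < n" "j < n" "k < n" "p \<in> topspace T" for i j k p
    using coord_levi_civita_frame[OF that] \<Gamma>[OF that] by simp
  have second: "coord k (?D (E l) (?D (E i) (E j))) p = - (\<Sum>m<n. c m j i * c m k l)"
    if "i < n" "j < n" "k < n" "l < n" for i j k l
    using levi_civita_const_coords[OF that(4,3) levi_civita_frame_field[OF that(1,2)] p coords[OF that(1-3)]]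
      coords[OF that(1,2) _ p] \<Gamma>[OF that(4,3) _ p] by simp
  let ?L = "lie_bracket (E i) (E j)"
  have "?L = (\<lambda>p f. \<Sum>k<n. c i j k * E k p f)"
  proof (rule vector_field_eqI[OF frame_bracket[OF i j]])
    show "(\<lambda>p f. \<Sum>k<n. c i j k * E k p f) \<in> vector_fields"
      by (rule vector_field_sum) (use frame_field smooth_fun_on_const in auto)
    show "coord k ?L q = coord k (\<lambda>p f. \<Sum>k<n. c i j k * E k p f) q" if "q \<in> topspace T" "k < n" for q k
      using const[OF i j that(2,1)] coord_sum[OF that] by (simp add: coord_def structure_fun_def)
  qed
  then have "?D ?L (E j) p = (\<lambda>f. \<Sum>k<n. c i j k * ?D (E k) (E j) p f)"
    using affine_connection_sum[OF levi_civita_connection(1) frame_field[OF j] frame_field, where m = n] by simp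
  then have third: "coord i (?D ?L (E j)) p = (\<Sum>k<n. c i j k * coord i (?D (E k) (E j)) p)"
    using metric_sum_left[OF p frame_tangent[OF i], of "{..<n}" "\<lambda>k. ?D (E k) (E j) p"]
      vector_field_tangent[OF levi_civita_frame_field[OF _ j]]
    by (simp add: coord_def)
  have f1: "?D (E i) (?D (E j) (E j)) \<in> vector_fields"
    by (rule levi_civita_vector_field[OF frame_field[OF i] levi_civita_frame_field[OF j j]])
  have f2: "?D (E j) (?D (E i) (E j)) \<in> vector_fields"
    by (rule levi_civita_vector_field[OF frame_field[OF j] levi_civita_frame_field[OF i j]])
  have f3: "?D ?L (E j) \<in> vector_fields"
    by (rule levi_civita_vector_field[OF frame_bracket[OF i j] frame_field[OF j]])
  have "g p (curvature ?D (E i) (E j) (E j) p) (E i p) =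
      coord i (?D (E i) (?D (E j) (E j))) p - coord i (?D (E j) (?D (E i) (E j))) p - coord i (?D ?L (E j)) p"
    using coord_vf_diff[OF vf_diff_vector_field[OF f1 f2] f3 p i] coord_vf_diff[OF f1 f2 p i]
    by (simp add: curvature_def coord_def)
  also have "coord i (?D (E i) (?D (E j) (E j))) p = - (\<Sum>k<n. c k j j * c k i i)"
    by (rule second[OF j j i i])
  also have "coord i (?D (E j) (?D (E i) (E j))) p = - (\<Sum>k<n. c k j i * c k i j)"
    by (rule second[OF i j i j])
  also have "coord i (?D ?L (E j)) p = (\<Sum>k<n. c i j k * c i j k)"
    unfolding third by (intro sum.cong refl) (simp add: coords[OF _ j i p])
  finally show ?thesis by (simp add: sum.distrib sum_subtractf sum_negf)
qed

lemma frame_independent: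
  assumes p: "p \<in> topspace T" and i: "i < n" and j: "j < n" and "i \<noteq> j"
  shows "linearly_independent_pair (E i p) (E j p)"
  unfolding linearly_independent_pair_def
proof (intro allI impI)
  fix a b assume z: "(\<lambda>f. a * E i p f + b * E j p f) = (\<lambda>f. 0)"
  have "a * g p (E i p) (E l p) + b * g p (E j p) (E l p) = 0" if "l < n" for l
    using metric_linear[OF p frame_tangent[OF i] frame_tangent[OF j] frame_tangent[OF that], of a b]
      metric_zero_left[OF p frame_tangent[OF that]] z by simp
  from this[OF i] this[OF j] show "a = 0 \<and> b = 0"
    using frame_orthonormal[OF p] i j \<open>i \<noteq> j\<close> by simp
qed

text \<open>
  The sum of all \<open>?K i j\<close> is the scalar curvature. Positive sectional curvature makes its off-diagonal terms
  positive, and \<open>n \<ge> 2\<close> provides one.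
\<close>
theorem cyclic_frame_not_positively_curved:
  assumes const: "\<And>i j k p. i < n \<Longrightarrow> j < n \<Longrightarrow> k < n \<Longrightarrow> p \<in> topspace T \<Longrightarrow> structure_fun i j k p = c i j k"
    and cyc: "\<And>i j k. i < n \<Longrightarrow> j < n \<Longrightarrow> k < n \<Longrightarrow> c i j k + c j k i + c k i j = 0"
    and n: "2 \<le> n" and p: "p \<in> topspace T"
  shows "\<not> positive_sectional_curvature"
proof
  assume pos: positive_sectional_curvature
  let ?K = "\<lambda>i j. \<Sum>k<n. - (c k j j * c k i i) + c k j i * c k i j - c i j k * c i j k"
  have off: "0 < ?K i j" if ij: "i < n" "j < n" "i \<noteq> j" for i j
  proof -
    have "0 < sectional_curvature p (E i) (E j)"
      using pos[unfolded positive_sectional_curvature_def, rule_format,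
          OF p frame_field[OF ij(1)] frame_field[OF ij(2)] frame_independent[OF p ij]] .
    then show ?thesis
      using frame_orthonormal[OF p] ij
      by (simp add: sectional_curvature_def frame_curvature[OF const cyc ij(1,2) p])
  qed
  have diag: "?K i i = 0" if "i < n" for i
  proof (rule sum.neutral, rule ballI)
    fix k assume "k \<in> {..<n}"
    then have "c i i k = 0"
      using structure_fun_antisym[OF that that _ p, of k] const[OF that that _ p] by simp
    then show "- (c k i i * c k i i) + c k i i * c k i i - c i i k * c i i k = 0" by simp
  qed
  have nonneg: "0 \<le> ?K i j" if "i < n" "j < n" for i j
    using off[OF that] diag[OF that(1)] by (cases "i = j") auto
  have row: "0 \<le> (\<Sum>j<n. ?K i j)" if "i < n" for i
    by (rule sum_nonneg) (use nonneg[OF that] in simp)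
  have "0 < (\<Sum>j<n. ?K 0 j)"
  proof (rule sum_pos2)
    show "finite {..<n}" "1 \<in> {..<n}" using n by auto
    show "0 < ?K 0 1" by (rule off) (use n in auto)
    show "0 \<le> ?K 0 j" if "j \<in> {..<n}" for j by (rule nonneg) (use n that in auto)
  qed
  have "0 < (\<Sum>i<n. \<Sum>j<n. ?K i j)"
  proof (rule sum_pos2)
    show "finite {..<n}" "0 \<in> {..<n}" using n by auto
    show "0 < (\<Sum>j<n. ?K 0 j)" by fact
    show "0 \<le> (\<Sum>j<n. ?K i j)" if "i \<in> {..<n}" for i by (rule row) (use that in auto)
  qed
  then show False using scalar_curvature_sum_nonpos[of c n] by linarith
qed

end

context metric_lie_group
begin

lemma left_invariant_metric_const:
  assumes X: "X \<in> left_invariant_fields" and Y: "Y \<in> left_invariant_fields" and p: "p \<in> carrier G"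
  shows "g p (X p) (Y p) = lie_algebra_inner X Y"
proof -
  have "g (p \<otimes> \<one>) (push_forward (\<lambda>x. p \<otimes> x) \<one> (X \<one>)) (push_forward (\<lambda>x. p \<otimes> x) \<one> (Y \<one>)) = g \<one> (X \<one>) (Y \<one>)"
    by (intro left_invariant_metric p one_closed vector_field_tangent left_invariant_vector_field X Y)
  then show ?thesis
    using left_invariant_push[OF X p one_closed] left_invariant_push[OF Y p one_closed] p
    by (simp add: lie_algebra_inner_def)
qed

text \<open>
  A chart identifies the tangent space at the unit with \<open>'e\<close>. The left-invariant extensions of a basis that is
  orthonormal there remain orthonormal by invariance of the metric. They span every tangent space because left
  translations are invertible.
\<close>
lemma left_invariant_orthonormal_frame:
  obtains E where "\<And>i. i < DIM('e) \<Longrightarrow> E i \<in> left_invariant_fields"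
    and "orthonormal_frame T A g E DIM('e)"
proof -
  obtain V \<psi> where ch: "(V, \<psi>) \<in> A" "\<one> \<in> V" by (rule chart_at[OF one_top])
  define d where "d = chart_derivation V \<psi> \<one>"
  have d_tangent: "d w \<in> tangent_space \<one>" for w
    unfolding d_def by (rule chart_derivation_tangent[OF ch])
  have d_add: "d (x + y) = (\<lambda>f. d x f + d y f)" for x y
    using chart_derivation_lincomb[OF ch, of 1 x 1 y] by (simp add: d_def)
  have d_scale: "d (a *\<^sub>R x) = (\<lambda>f. a * d x f)" for a x
    using chart_derivation_lincomb[OF ch, of a x 0 x] by (simp add: d_def)
  have d_linear: "linear (\<lambda>w. d w f)" for f
    by (rule linearI) (simp_all add: d_add d_scale)
  define B where "B w w' = g \<one> (d w) (d w')" for w w'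
  have B_linear: "linear (\<lambda>x. B x z)" for z
    by (rule linearI)
      (simp_all add: B_def d_add d_scale metric_add_left[OF one_top d_tangent d_tangent d_tangent]
        metric_scale_left[OF one_top d_tangent d_tangent])
  have B_sym: "B x y = B y x" for x y
    unfolding B_def by (rule metric_sym[OF one_top d_tangent d_tangent])
  have B_pos: "0 < B x x" if "x \<noteq> 0" for x
    unfolding B_def
  proof (rule metric_pos[OF one_top d_tangent], rule notI)
    assume "d x = (\<lambda>f. 0)"
    then have "x \<bullet> b = 0" for b using chart_derivation_coordinate[OF ch, of x b] by (simp add: d_def)
    then show False using that by (metis inner_eq_zero_iff)
  qed
  obtain e :: "nat \<Rightarrow> 'e" where e: "\<And>i j. i < DIM('e) \<Longrightarrow> j < DIM('e) \<Longrightarrow> B (e i) (e j) = (if i = j then 1 else 0)"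
    and expand: "\<And>x. x = (\<Sum>i<DIM('e). B x (e i) *\<^sub>R e i)"
    by (rule orthonormal_basis_of_inner_product[of B, OF B_linear B_sym B_pos]) blast+
  define E where "E i = left_field (d (e i))" for i
  have inv: "E i \<in> left_invariant_fields" for i
    unfolding E_def by (rule left_field_left_invariant[OF d_tangent])
  have field: "E i \<in> vector_fields" for i by (rule left_invariant_vector_field[OF inv])
  have orth: "g p (E i p) (E j p) = (if i = j then 1 else 0)"
    if p: "p \<in> topspace T" and "i < DIM('e)" "j < DIM('e)" for p i j
    using left_invariant_metric_const[OF inv inv, of p i j] p e[OF that(2,3)]
    by (simp add: topspace_carrier lie_algebra_inner_def E_def left_field_one[OF d_tangent] B_def)
  have span: "u = (\<lambda>f. \<Sum>i<DIM('e). g p u (E i p) * E i p f)"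
    if p: "p \<in> topspace T" and u: "u \<in> tangent_space p" for p u
  proof -
    have pG: "p \<in> carrier G" using p by (simp add: topspace_carrier)
    define v where "v = push_forward (\<lambda>x. inv p \<otimes> x) p u"
    have v: "v \<in> tangent_space \<one>"
      using left_translate_tangent[OF u inv_closed[OF pG] pG] pG by (simp add: v_def)
    have "push_forward (\<lambda>x. p \<otimes> x) \<one> v = u"
      using left_translate_compose[OF u pG inv_closed[OF pG] pG] push_forward_one[OF u pG] pG
      by (simp add: v_def)
    then have uv: "u = left_field v p" by (simp add: left_field_eq_push_forward[OF pG])
    obtain w where w: "v = d w" unfolding d_def using tangent_eq_chart_derivation[OF ch v] by blast
    define a where "a i = B w (e i)" for i
    have dw: "d w h = (\<Sum>i<DIM('e). a i * d (e i) h)" for h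
      using arg_cong[OF expand[of w], of "\<lambda>w. d w h"]
      by (simp add: linear_sum[OF d_linear] linear_cmul[OF d_linear] a_def)
    have ua: "u = (\<lambda>f. \<Sum>i<DIM('e). a i * E i p f)"
      unfolding uv w E_def by (rule ext) (simp add: left_field_def dw)
    have "g p u (E k p) = a k" if k: "k < DIM('e)" for k
    proof -
      have "g p u (E k p) = (\<Sum>i<DIM('e). a i * g p (E i p) (E k p))"
        unfolding ua by (rule metric_sum_left[OF p vector_field_tangent[OF field] vector_field_tangent[OF field]])
      also have "\<dots> = (\<Sum>i<DIM('e). if i = k then a i else 0)"
        by (rule sum.cong) (use orth[OF p _ k] in auto)
      finally show ?thesis using k by simp
    qed
    then have "(\<lambda>f. \<Sum>i<DIM('e). g p u (E i p) * E i p f) = (\<lambda>f. \<Sum>i<DIM('e). a i * E i p f)"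
      by simp
    with ua show ?thesis by (rule trans[OF _ sym])
  qed
  have "orthonormal_frame T A g E DIM('e)"
  proof (unfold_locales)
    show "E i \<in> vector_fields" for i by (rule field)
    show "g p (E i p) (E j p) = (if i = j then 1 else 0)"
      if "p \<in> topspace T" "i < DIM('e)" "j < DIM('e)" for p i j by (rule orth[OF that])
    show "u = (\<lambda>f. \<Sum>i<DIM('e). g p u (E i p) * E i p f)"
      if "p \<in> topspace T" "u \<in> tangent_space p" for p u by (rule span[OF that])
  qed
  with inv show thesis by (rule that)
qed

theorem cyclic_not_positively_curved:
  assumes "2 \<le> DIM('e)" and cyc: cyclic
  shows "\<not> positive_sectional_curvature"
proof -
  obtain E where inv: "\<And>i. i < DIM('e) \<Longrightarrow> E i \<in> left_invariant_fields"
    and frame: "orthonormal_frame T A g E DIM('e)" by (rule left_invariant_orthonormal_frame) blast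
  interpret F: orthonormal_frame T A g E "DIM('e)" by (rule frame)
  let ?c = "\<lambda>i j k. lie_algebra_inner (lie_bracket (E i) (E j)) (E k)"
  show ?thesis
  proof (rule F.cyclic_frame_not_positively_curved[where c = ?c, OF _ _ assms(1) one_top])
    fix i j k p assume ijk: "i < DIM('e)" "j < DIM('e)" "k < DIM('e)"
    show "F.structure_fun i j k p = ?c i j k" if "p \<in> topspace T"
      using left_invariant_metric_const[OF lie_bracket_left_invariant[OF inv inv] inv, of i j k p] ijk that
      by (simp add: F.structure_fun_def topspace_carrier)
    show "?c i j k + ?c j k i + ?c k i j = 0"
      using cyc[unfolded cyclic_def, rule_format, OF inv[OF ijk(1)] inv[OF ijk(2)] inv[OF ijk(3)]] .
  qed
qed

end

theorem corollary4p3: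
  assumes "2 \<le> DIM('e::euclidean_space)"
  shows "\<nexists>(G :: ('a, 'b) monoid_scheme) T (A :: ('a, 'e) chart set) g.
           metric_lie_group G T A g \<and>
           metric_lie_group.cyclic G T A g \<and>
           riemannian_manifold.positive_sectional_curvature T A g"
  using metric_lie_group.cyclic_not_positively_curved[OF _ assms] by blast

end
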